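(* Let $(A_i)_{i\in I}$ be the collection of all infinite arithmetic progressions $\{mh+b : h=0,1,2,\dots\}$ (with $m,b$ positive integers) consisting of positive odd integers and contained in $\mathcal{U}$. Let $a\in\mathcal{U}$. Then $a\in\bigcup_{i\in I}A_i$ if and only if there is an integer $m>1$ such that $\gcd(a-2^k,m)>1$ for every positive integer $k$.
   Context: $\mathcal{U}$ denotes the set of positive odd integers $n$ that cannot be written as $n=p+2^k$ with $p$ a prime and $k$ a positive integer. *)

theory Defs
  imports "HOL-Computational_Algebra.Primes"
begin

definition \<U> :: "nat set" where
  "\<U> = {n. n > 0 \<and> odd n \<and> \<not> (\<exists>p k :: nat. prime p \<and> k > 0 \<and> n = p + 2 ^ k)}"

definition arith_prog :: "nat \<Rightarrow> nat \<Rightarrow> nat set" where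
  "arith_prog m b = {m * h + b | h :: nat. True}"

definition progressions_in_\<U> :: "nat set set" where
  "progressions_in_\<U> =
     {arith_prog m b | m b. m > 0 \<and> b > 0 \<and>
        (\<forall>n \<in> arith_prog m b. n > 0 \<and> odd n) \<and> arith_prog m b \<subseteq> \<U>}"

end

theory Submission
  imports Defs "HOL-Number_Theory.Number_Theory" "HOL-Computational_Algebra.Squarefree"
begin

text \<open>
  If a progression through \<open>a\<close> with modulus \<open>M\<close> lies in \<open>\<U>\<close> and some \<open>a - 2^k\<close> were coprime to \<open>M\<close>,
  Dirichlet's theorem would give a prime \<open>p \<equiv> a - 2^k\<close> modulo \<open>M\<close> with \<open>p > a\<close>, and \<open>p + 2^k\<close> would be
  in the progression. Conversely, if \<open>m\<close> shares a factor with every \<open>a - 2^k\<close>, then a prime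
  \<open>a + M h - 2^k\<close> with \<open>m dvd M\<close> divides \<open>m\<close>, and \<open>M = 3 m 2^t\<close> with \<open>2^t\<close> large rules this out.

  Dirichlet's theorem is proved by Shapiro's elementary method: the sums
  \<open>\<Sum>n\<le>N. \<chi>(n) \<Lambda>(n) / n\<close> equal \<open>ln N + O(1)\<close> for the principal character, \<open>O(1)\<close> if \<open>L(1,\<chi>) \<noteq> 0\<close> and
  \<open>-ln N + O(1)\<close> if \<open>L(1,\<chi>) = 0\<close>. Their sum over all \<open>\<chi>\<close> is nonnegative, so \<open>L(1,\<chi>)\<close> vanishes for at
  most one character, which is then real; Monsky's argument excludes real characters.
\<close>

text \<open>Each Mangoldt asymptotic comes from collecting terms with \<open>d * q = n\<close>. For
  nonprincipal \<chi>, weighting the identity ln n = \<Sum> \<Lambda>(d) over d dvd n by \<chi>(n)/n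
  turns the bounded sum of \<chi>(n) ln n / n into L(1,\<chi>) times the Mangoldt sum, up to tails
  of the L-series. The tail beyond N/d is O(d/N); its factor d cancels the weight 1/d, and what
  remains is (1/N) \<Sum> \<Lambda>(d), which Chebyshev's bound controls.

  The nonnegativity behind the vanishing argument belongs to the residue class 1: adding \<chi>(n)
  over all \<chi> gives a nonnegative multiple of the indicator of n \<equiv> 1. The principal
  character gains one ln N and every zero costs one. A nonreal zero comes with its conjugate, so the
  balance turns negative; a single real zero would balance exactly, and growth alone cannot exclude
  it. That is why real characters need a separate argument.\<close>

section \<open>Divisor sums and the Moebius function\<close>

lemma sum_divisors_swap:
  fixes F :: "nat \<Rightarrow> nat \<Rightarrow> 'a :: comm_monoid_add"
  shows "(\<Sum>n\<in>{1..N}. \<Sum>d | d dvd n. F d (n div d)) = (\<Sum>d\<in>{1..N}. \<Sum>q\<in>{1..N div d}. F d q)"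
proof -
  have "(\<Sum>n\<in>{1..N}. \<Sum>d | d dvd n. F d (n div d))
      = (\<Sum>(n, d)\<in>(SIGMA n:{1..N}. {d. d dvd n}). F d (n div d))"
    by (subst sum.Sigma) auto
  also have "\<dots> = (\<Sum>(d, q)\<in>(SIGMA d:{1..N}. {1..N div d}). F d q)"
  proof (rule sum.reindex_bij_witness[where i = "\<lambda>(d, q). (d * q, d)" and j = "\<lambda>(n, d). (d, n div d)"], goal_cases)
    case (2 a)
    then obtain n d where [simp]: "a = (n, d)" and nd: "n \<ge> 1" "n \<le> N" "d dvd n" by auto
    then obtain q where q: "n = d * q" by auto
    with nd have "d > 0" "q > 0" by (auto intro: Nat.gr0I)
    moreover have "d \<le> N" using nd dvd_imp_le[of d n] by simp
    ultimately show ?case using q nd by (auto simp: less_eq_div_iff_mult_less_eq mult.commute)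
  next
    case (4 b)
    then obtain d q where [simp]: "b = (d, q)" and dq: "d \<ge> 1" "d \<le> N" "q \<ge> 1" "q \<le> N div d" by auto
    then have "d * q \<le> N" by (auto simp: less_eq_div_iff_mult_less_eq mult.commute)
    thus ?case using dq by (auto simp: Suc_le_eq)
  qed (auto simp: Suc_le_eq)
  also have "\<dots> = (\<Sum>d\<in>{1..N}. \<Sum>q\<in>{1..N div d}. F d q)"
    by (subst sum.Sigma) auto
  finally show ?thesis .
qed

lemma nat_div_real_bounds:
  fixes N d :: nat
  assumes "d > 0"
  shows "real (N div d) \<le> real N / real d" and "real N / real d < real (N div d) + 1"
proof -
  show "real (N div d) \<le> real N / real d" using of_nat_div_le_of_nat[of N d] by simp
  have "real N < real ((N div d + 1) * d)"
    using assms by (metis Suc_eq_plus1 dividend_less_div_times mult.commute mult_Suc_right of_nat_less_iff add.commute)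
  thus "real N / real d < real (N div d) + 1"
    using assms by (simp add: field_simps)
qed

definition moebius :: "nat \<Rightarrow> real" where
  "moebius n = (if squarefree n then (- 1) ^ card (prime_factors n) else 0)"

lemma moebius_1 [simp]: "moebius (Suc 0) = 1"
  by (simp add: moebius_def)

lemma abs_moebius_le: "\<bar>moebius n\<bar> \<le> 1"
  by (simp add: moebius_def power_abs)

lemma moebius_prime_mult:
  assumes "prime p" "\<not> p dvd d"
  shows "moebius (p * d) = - moebius d"
proof -
  have d: "d \<noteq> 0" using assms by (auto intro: Nat.gr0I)
  have cop: "coprime p d" using assms by (simp add: prime_imp_coprime)
  have sq: "squarefree (p * d) \<longleftrightarrow> squarefree d"
    using cop assms(1) by (auto simp: squarefree_mult_coprime squarefree_prime dest: squarefree_multD)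
  have "prime_factors (p * d) = insert p (prime_factors d)"
    using assms d by (simp add: prime_factors_product prime_prime_factors)
  moreover have "p \<notin> prime_factors d" using assms by auto
  ultimately show ?thesis using sq by (simp add: moebius_def)
qed

text \<open>Fix a prime \<open>p\<close> dividing \<open>n\<close>. The squarefree divisors of
  \<open>n\<close> pair off as \<open>d\<close> and \<open>p * d\<close> with \<open>d\<close> prime
  to \<open>p\<close>, and the two members of a pair have opposite signs.\<close>

lemma sum_moebius_divisors:
  assumes "n > 0"
  shows "(\<Sum>d | d dvd n. moebius d) = (if n = 1 then 1 else 0)"
proof (cases "n = 1")
  case False
  then obtain p where p: "prime p" "p dvd n" using prime_factor_nat by blast
  define A where "A = {d. d dvd n \<and> \<not> p dvd d \<and> squarefree d}"
  have finA: "finite A" using assms by (auto simp: A_def intro: finite_subset[of _ "{d. d dvd n}"])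
  have p0: "p > 0" using p by (simp add: prime_gt_0_nat)
  have "(\<Sum>d | d dvd n. moebius d) = (\<Sum>d\<in>A \<union> (*) p ` A. moebius d)"
  proof (rule sum.mono_neutral_right)
    show "A \<union> (*) p ` A \<subseteq> {d. d dvd n}"
      using p by (auto simp: A_def intro!: divides_mult prime_imp_coprime)
    show "\<forall>d\<in>{d. d dvd n} - (A \<union> (*) p ` A). moebius d = 0"
    proof
      fix d assume d: "d \<in> {d. d dvd n} - (A \<union> (*) p ` A)"
      show "moebius d = 0"
      proof (rule ccontr)
        assume "moebius d \<noteq> 0"
        hence sq: "squarefree d" by (auto simp: moebius_def split: if_splits)
        with d have "p dvd d" by (auto simp: A_def)
        then obtain e where e: "d = p * e" by auto
        have "\<not> p dvd e"
          using squarefreeD[OF sq, of p] mult_dvd_mono[OF dvd_refl[of p], of p e] e p(1)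
          by (auto simp: power2_eq_square)
        moreover have "squarefree e" using sq e by (auto dest: squarefree_multD)
        ultimately have "e \<in> A" using d e by (auto simp: A_def dest: dvd_mult_right)
        thus False using d e by auto
      qed
    qed
  qed (use assms in auto)
  also have "\<dots> = (\<Sum>d\<in>A. moebius d) + (\<Sum>d\<in>(*) p ` A. moebius d)"
    by (rule sum.union_disjoint) (use finA in \<open>auto simp: A_def\<close>)
  also have "(\<Sum>d\<in>(*) p ` A. moebius d) = (\<Sum>d\<in>A. moebius (p * d))"
    using p0 by (subst sum.reindex) (auto simp: inj_on_def)
  also have "\<dots> = (\<Sum>d\<in>A. - moebius d)"
    by (rule sum.cong) (auto simp: A_def moebius_prime_mult p)
  finally show ?thesis using False by (simp add: sum_negf)
qed simp

text \<open>Both sides run over the pairs with \<open>d * e\<close> dividing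
  \<open>n\<close>.\<close>

lemma sum_divisors_swap_nested:
  fixes f g :: "nat \<Rightarrow> 'a :: comm_semiring_0"
  assumes "n > 0"
  shows "(\<Sum>d | d dvd n. f d * (\<Sum>e | e dvd n div d. g e)) = (\<Sum>e | e dvd n. g e * (\<Sum>d | d dvd n div e. f d))"
proof -
  have fin: "finite {e. e dvd n div d}" if "d dvd n" for d
    using assms that by (intro finite_divisors_nat) (auto simp: dvd_def)
  have sw: "d dvd n \<and> e dvd n div d \<longleftrightarrow> d * e dvd n" for d e
    using assms by (metis (no_types, opaque_lifting) bot_nat_0.not_eq_extremum dvd_div_iff_mult dvd_mult_left mult.commute mult_0 dvd_0_left_iff)
  have Sig: "(SIGMA d:{d. d dvd n}. {e. e dvd n div d}) = {(d, e). d * e dvd n}"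
    using sw by auto
  have "(\<Sum>d | d dvd n. f d * (\<Sum>e | e dvd n div d. g e))
      = (\<Sum>(d,e)\<in>(SIGMA d:{d. d dvd n}. {e. e dvd n div d}). f d * g e)"
    using assms fin by (subst sum.Sigma [symmetric]) (auto simp: sum_distrib_left)
  also have "\<dots> = (\<Sum>(e,d)\<in>(SIGMA d:{d. d dvd n}. {e. e dvd n div d}). f d * g e)"
    unfolding Sig by (rule sum.reindex_bij_witness[where i = prod.swap and j = prod.swap])
      (auto simp: mult.commute)
  also have "\<dots> = (\<Sum>e | e dvd n. g e * (\<Sum>d | d dvd n div e. f d))"
    using assms fin by (subst sum.Sigma [symmetric]) (auto simp: sum_distrib_left mult.commute)
  finally show ?thesis .
qed

text \<open>Moebius inversion of the divisor sum of \<open>mangoldt\<close> gives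
  \<open>mangoldt n\<close> as the sum of \<open>moebius d * ln (n / d)\<close>. Splitting the
  logarithm leaves the multiple \<open>ln n\<close> of the Moebius sum, which vanishes: for
  \<open>n = 1\<close> because of the logarithm, otherwise because of the sum.\<close>

lemma sum_moebius_ln_divisors:
  assumes "n > 0"
  shows "(\<Sum>d | d dvd n. moebius d * ln (real d)) = - mangoldt n"
proof -
  have "(\<Sum>d | d dvd n. moebius d * ln (real (n div d)))
      = (\<Sum>d | d dvd n. moebius d * (\<Sum>e | e dvd n div d. mangoldt e))"
    using assms by (intro sum.cong refl, subst mangoldt_sum) (auto simp: dvd_def)
  also have "\<dots> = (\<Sum>e | e dvd n. mangoldt e * (\<Sum>d | d dvd n div e. moebius d))"
    by (rule sum_divisors_swap_nested) fact
  also have "\<dots> = (\<Sum>e | e dvd n. if e = n then mangoldt e else 0)"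
  proof (intro sum.cong refl)
    fix e assume e: "e \<in> {e. e dvd n}"
    hence "n div e > 0" "n div e = 1 \<longleftrightarrow> e = n"
      using assms by (auto simp: dvd_def)
    thus "mangoldt e * (\<Sum>d | d dvd n div e. moebius d) = (if e = n then mangoldt e else (0::real))"
      by (simp add: sum_moebius_divisors)
  qed
  also have "\<dots> = mangoldt n"
    using assms by (simp add: sum.delta)
  finally have *: "(\<Sum>d | d dvd n. moebius d * ln (real (n div d))) = mangoldt n" .
  have "(\<Sum>d | d dvd n. moebius d * ln (real (n div d)))
      = (\<Sum>d | d dvd n. ln (real n) * moebius d - moebius d * ln (real d))"
  proof (intro sum.cong refl)
    fix d assume "d \<in> {d. d dvd n}"
    then obtain q where q: "n = d * q" by auto
    hence "d > 0" "q > 0" using assms by (auto intro: Nat.gr0I)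
    thus "moebius d * ln (real (n div d)) = ln (real n) * moebius d - moebius d * ln (real d)"
      using q by (simp add: ln_mult algebra_simps)
  qed
  also have "\<dots> = ln (real n) * (\<Sum>d | d dvd n. moebius d) - (\<Sum>d | d dvd n. moebius d * ln (real d))"
    by (simp add: sum_subtractf sum_distrib_left)
  also have "ln (real n) * (\<Sum>d | d dvd n. moebius d) = 0"
    using assms by (simp add: sum_moebius_divisors)
  finally show ?thesis using * by simp
qed

section \<open>Chebyshev and Mertens estimates\<close>

lemma ln_fact_lower: "real N * ln (real N) - real N \<le> ln (fact N)"
proof (induction N)
  case (Suc N)
  show ?case
  proof (cases "N = 0")
    case False
    have "1 + 1 / real N = real (Suc N) / real N" using False by (simp add: field_simps)
    hence "ln (real (Suc N)) - ln (real N) = ln (1 + 1 / real N)"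
      using False by (simp only: ln_div of_nat_0_less_iff) (simp add: ln_div)
    also have "\<dots> \<le> 1 / real N" by (rule ln_add_one_self_le_self) auto
    finally have "real N * (ln (real (Suc N)) - ln (real N)) \<le> 1"
      using False by (simp add: field_simps)
    moreover have "ln (fact (Suc N) :: real) = ln (real (Suc N)) + ln (fact N)"
      by (simp add: ln_mult del: of_nat_Suc)
    ultimately show ?thesis using Suc by (simp add: algebra_simps)
  qed simp
qed simp

lemma ln_fact_eq_sum_ln: "ln (fact N :: real) = (\<Sum>n\<in>{1..N}. ln (real n))"
proof (induction N)
  case (Suc N)
  have "ln (fact (Suc N) :: real) = ln (real (Suc N)) + ln (fact N)"
    by (simp add: ln_mult del: of_nat_Suc)
  thus ?case using Suc by simp
qed simp

lemma ln_fact_upper: "ln (fact N :: real) \<le> real N * ln (real N)"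
proof -
  have "ln (fact N :: real) \<le> (\<Sum>n\<in>{1..N}. ln (real N))"
    unfolding ln_fact_eq_sum_ln by (intro sum_mono) auto
  thus ?thesis by simp
qed

text \<open>Legendre's formula for the prime exponents of a factorial, in logarithmic form.\<close>

lemma ln_fact_eq_sum_mangoldt: "ln (fact N :: real) = (\<Sum>d\<in>{1..N}. mangoldt d * real (N div d))"
proof -
  have "ln (fact N :: real) = (\<Sum>n\<in>{1..N}. \<Sum>d | d dvd n. mangoldt d)"
    unfolding ln_fact_eq_sum_ln by (intro sum.cong refl, subst mangoldt_sum) auto
  also have "\<dots> = (\<Sum>d\<in>{1..N}. \<Sum>q\<in>{1..N div d}. mangoldt d)"
    using sum_divisors_swap[of "\<lambda>d q. mangoldt d" N] .
  finally show ?thesis by (simp add: mult.commute)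
qed

text \<open>The middle binomial coefficient is at most \<open>2 ^ N\<close>. The factor
  \<open>N\<close> absorbs the odd case, in which \<open>N - k\<close> is
  \<open>k + 1\<close>.\<close>

lemma fact_le_fact_half: 
  assumes "N > 0"
  shows "fact N \<le> 2 ^ N * N * (fact (N div 2) :: nat) ^ 2"
proof -
  define k where "k = N div 2"
  have k: "k \<le> N" by (simp add: k_def)
  have "N - k = k \<or> N - k = Suc k" unfolding k_def by presburger
  hence "(fact (N - k) :: nat) \<le> N * fact k"
  proof
    assume e: "N - k = Suc k"
    hence "Suc k \<le> N" by simp
    thus ?thesis unfolding e fact_Suc by (intro mult_right_mono) auto
  qed (use assms in auto)
  moreover have "N choose k \<le> 2 ^ N" by (rule binomial_le_pow2)
  moreover have "(fact N :: nat) = (fact k * fact (N - k)) * (N choose k)"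
    using binomial_fact_lemma[OF k] by simp
  ultimately have "(fact N :: nat) \<le> (fact k * (N * fact k)) * 2 ^ N"
    by (metis mult_le_mono mult_le_mono2)
  thus ?thesis by (simp add: k_def power2_eq_square algebra_simps)
qed

text \<open>Chebyshev's device: in ln N! - 2 ln (N div 2)! the coefficient of
  \<open>mangoldt d\<close> is the parity of \<open>N div d\<close>, which is 1 for d in the upper
  half. That half therefore contributes at most \<open>2 * N\<close>, and repeated halving doubles
  the constant to 4.\<close>

lemma sum_mangoldt_le: "(\<Sum>d\<in>{1..N}. mangoldt d) \<le> 4 * real N"
proof (induction N rule: less_induct)
  case (less N)
  show ?case
  proof (cases "N = 0")
    case False
    define k where "k = N div 2"
    have kN: "k < N" using False by (simp add: k_def)
    have "ln (fact k :: real) = (\<Sum>d\<in>{1..N}. mangoldt d * real (k div d))"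
      unfolding ln_fact_eq_sum_mangoldt using kN by (intro sum.mono_neutral_left) auto
    hence eq: "ln (fact N :: real) - 2 * ln (fact k) = (\<Sum>d\<in>{1..N}. mangoldt d * (real (N div d) - 2 * real (k div d)))"
      by (simp add: ln_fact_eq_sum_mangoldt[of N] sum_subtractf sum_distrib_left algebra_simps)
    have coeff: "real (N div d) - 2 * real (k div d) = real ((N div d) mod 2)" for d
    proof -
      have "k div d = (N div d) div 2"
        unfolding k_def by (simp add: div_mult2_eq [symmetric] mult.commute)
      moreover have "N div d = 2 * ((N div d) div 2) + (N div d) mod 2" by simp
      ultimately show ?thesis by (metis add_diff_cancel_left' of_nat_add of_nat_mult of_nat_numeral)
    qed
    have "(\<Sum>d\<in>{1..N}. mangoldt d) - (\<Sum>d\<in>{1..k}. mangoldt d) = (\<Sum>d\<in>{1..N} - {1..k}. mangoldt d :: real)"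
      using kN by (subst sum_diff) auto
    also have "\<dots> \<le> (\<Sum>d\<in>{1..N} - {1..k}. mangoldt d * real ((N div d) mod 2))"
    proof (rule sum_mono)
      fix d assume "d \<in> {1..N} - {1..k}"
      hence d: "d \<le> N" "k < d" by auto
      hence "N < 2 * d" unfolding k_def by linarith
      hence "N div d = 1" using d by (intro div_nat_eqI) auto
      thus "(mangoldt d :: real) \<le> mangoldt d * real ((N div d) mod 2)" by simp
    qed
    also have "\<dots> \<le> (\<Sum>d\<in>{1..N}. mangoldt d * real ((N div d) mod 2))"
      by (rule sum_mono2) (auto simp: mangoldt_nonneg)
    also have "\<dots> = ln (fact N :: real) - 2 * ln (fact k)"
      using eq coeff by simp
    also have "\<dots> \<le> real N * ln 2 + ln (real N)"
    proof -
      have "real (fact N) \<le> real (2 ^ N * N * (fact k) ^ 2)"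
        using fact_le_fact_half[of N] False unfolding k_def by (subst of_nat_le_iff) auto
      hence "ln (fact N :: real) \<le> ln (2 ^ N * real N * (fact k) ^ 2)"
        using False by (subst ln_le_cancel_iff) auto
      also have "\<dots> = real N * ln 2 + ln (real N) + 2 * ln (fact k)"
        using False by (simp add: ln_mult ln_realpow)
      finally show ?thesis by simp
    qed
    also have "\<dots> \<le> 2 * real N"
    proof -
      have "ln (real N) \<le> real N - 1" using False by (intro ln_le_minus_one) auto
      moreover have "real N * ln 2 \<le> real N * 1" using ln_le_minus_one[of 2] by (intro mult_left_mono) auto
      ultimately show ?thesis by simp
    qed
    finally have "(\<Sum>d\<in>{1..N}. mangoldt d) \<le> 2 * real N + (\<Sum>d\<in>{1..k}. mangoldt d)" by simp
    also have "\<dots> \<le> 2 * real N + 4 * real k" using less.IH[OF kN] by simp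
    also have "\<dots> \<le> 4 * real N" by (simp add: k_def)
    finally show ?thesis .
  qed simp
qed

text \<open>Replacing \<open>N div d\<close> by \<open>N / d\<close> in Legendre's formula costs at
  most the Chebyshev sum, and dividing by \<open>N\<close> turns this into a bounded error.\<close>

lemma mertens_mangoldt:
  assumes "N > 0"
  shows "\<bar>(\<Sum>d\<in>{1..N}. mangoldt d / real d) - ln (real N)\<bar> \<le> 4"
proof -
  define M where "M = (\<Sum>d\<in>{1..N}. mangoldt d / real d :: real)"
  have NM: "real N * M = (\<Sum>d\<in>{1..N}. mangoldt d * (real N / real d))"
    by (simp add: M_def sum_distrib_left algebra_simps)
  have "ln (fact N) \<le> real N * M"
    unfolding NM ln_fact_eq_sum_mangoldt
    by (intro sum_mono mult_left_mono nat_div_real_bounds(1)) (auto simp: mangoldt_nonneg)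
  with ln_fact_lower[of N] have "real N * (ln (real N) - 1) \<le> real N * M" by (simp add: algebra_simps)
  hence 1: "ln (real N) - 1 \<le> M" using assms by simp
  have "real N * M \<le> (\<Sum>d\<in>{1..N}. mangoldt d * (real (N div d) + 1))"
    unfolding NM by (intro sum_mono mult_left_mono less_imp_le[OF nat_div_real_bounds(2)]) (auto simp: mangoldt_nonneg)
  also have "\<dots> = ln (fact N) + (\<Sum>d\<in>{1..N}. mangoldt d)"
    by (simp add: ln_fact_eq_sum_mangoldt sum.distrib algebra_simps)
  also have "\<dots> \<le> real N * (ln (real N) + 4)"
    using ln_fact_upper[of N] sum_mangoldt_le[of N] by (simp add: algebra_simps)
  finally have "M \<le> ln (real N) + 4" using assms by simp
  with 1 show ?thesis unfolding M_def [symmetric] by linarith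
qed

lemma geometric_tail_le:
  fixes x :: real
  assumes "0 \<le> x" "x \<le> 1 / 2"
  shows "(\<Sum>k\<in>{a..N}. x ^ k) \<le> 2 * x ^ a"
proof -
  \<comment> \<open>The extra term bounds the rest of the series and makes the induction go
    through.\<close>
  have "(\<Sum>k\<in>{a..<a + n}. x ^ k) + 2 * x ^ (a + n) \<le> 2 * x ^ a" for n
  proof (induction n)
    case (Suc n)
    have "x * x ^ (a + n) \<le> (1 / 2) * x ^ (a + n)" using assms by (intro mult_right_mono) auto
    thus ?case using Suc by simp
  qed simp
  from this[of "Suc N - a"] have "(\<Sum>k\<in>{a..<a + (Suc N - a)}. x ^ k) \<le> 2 * x ^ a"
    using assms by (smt (verit) zero_le_power)
  moreover have "{a..N} = {a..<a + (Suc N - a)}" by auto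
  ultimately show ?thesis by simp
qed

text \<open>A common bound for two uses: exponents from 2 on for nonprimes, and from 1 on for
  numbers sharing a factor with the modulus. Each base contributes a geometric tail.
  \<open>P\<close> may contain composite numbers, so a full interval \<open>{2..N}\<close> can serve
  as the set of bases.\<close>

lemma sum_mangoldt_prime_powers_le:
  assumes "finite S" "finite P" "\<And>p. p \<in> P \<Longrightarrow> p \<ge> 2"
    and S: "\<And>n. n \<in> S \<Longrightarrow> primepow n \<Longrightarrow> \<exists>p\<in>P. \<exists>k\<ge>a. prime p \<and> n = p ^ k"
  shows "(\<Sum>n\<in>S. mangoldt n / real n) \<le> (\<Sum>p\<in>P. 2 * ln (real p) / real p ^ a)"
proof -
  define N where "N = Max (insert 0 S)"
  define S' where "S' = {n\<in>S. primepow n}"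
  define T where "T = {x \<in> P \<times> {a..N}. prime (fst x)}"
  have finT: "finite T" using assms by (auto simp: T_def)
  have "(\<Sum>n\<in>S. mangoldt n / real n) = (\<Sum>n\<in>S'. mangoldt n / real n :: real)"
    using assms by (intro sum.mono_neutral_right) (auto simp: S'_def mangoldt_def)
  also have "\<dots> \<le> (\<Sum>n\<in>(\<lambda>(p,k). p ^ k) ` T. mangoldt n / real n)"
  proof (intro sum_mono2)
    show "S' \<subseteq> (\<lambda>(p,k). p ^ k) ` T"
    proof
      fix n assume n: "n \<in> S'"
      then obtain p k where pk: "p \<in> P" "k \<ge> a" "prime p" "n = p ^ k"
        using S[of n] by (auto simp: S'_def)
      have "k < p ^ k" using prime_gt_1_nat[OF pk(3)] by (intro power_gt_expt) auto
      also have "p ^ k \<le> N" using n assms(1) pk by (auto simp: N_def S'_def intro!: Max_ge)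
      finally show "n \<in> (\<lambda>(p,k). p ^ k) ` T" using pk by (auto simp: T_def intro!: image_eqI[of _ _ "(p,k)"])
    qed
  qed (use finT in \<open>auto simp: mangoldt_nonneg\<close>)
  also have "\<dots> \<le> (\<Sum>x\<in>T. case x of (p,k) \<Rightarrow> mangoldt (p ^ k) / real (p ^ k))"
    by (rule order_trans[OF sum_image_le]) (use finT in \<open>auto simp: mangoldt_nonneg case_prod_unfold\<close>)
  also have "\<dots> \<le> (\<Sum>x\<in>P \<times> {a..N}. case x of (p,k) \<Rightarrow> ln (real p) * (1 / real p) ^ k)"
  proof (rule sum_le_included[where i = id])
    show "\<forall>x\<in>P \<times> {a..N}. 0 \<le> (case x of (p, k) \<Rightarrow> ln (real p) * (1 / real p) ^ k)"
      using assms(3) by fastforce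
  qed (use assms finT in \<open>auto simp: T_def mangoldt_primepow power_divide Suc_le_eq prime_gt_0_nat intro!: ln_ge_zero\<close>)
  also have "\<dots> = (\<Sum>p\<in>P. ln (real p) * (\<Sum>k\<in>{a..N}. (1 / real p) ^ k))"
    by (simp add: sum.cartesian_product [symmetric] sum_distrib_left)
  also have "\<dots> \<le> (\<Sum>p\<in>P. ln (real p) * (2 * (1 / real p) ^ a))"
  proof (intro sum_mono mult_left_mono geometric_tail_le)
    fix p assume p: "p \<in> P"
    show "1 / real p \<le> 1 / 2" using assms(3)[OF p] by (simp add: field_simps)
    show "0 \<le> ln (real p)" using assms(3)[OF p] by simp
  qed auto
  finally show ?thesis by (simp add: power_divide mult.commute)
qed

lemma ln_le_2_sqrt:
  assumes "x > 0"
  shows "ln x \<le> 2 * sqrt x"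
proof -
  have "ln x = 2 * ln (sqrt x)" using assms by (simp add: ln_sqrt)
  also have "ln (sqrt x) \<le> sqrt x - 1" using assms by (intro ln_le_minus_one) auto
  finally show ?thesis by simp
qed

text \<open>Since ln n is at most 2 sqrt n, the terms are at most 4 / n^(3/2), and these are
  dominated by the differences of the telescoping sequence 8 / sqrt n.\<close>

lemma sum_ln_over_square_le: "(\<Sum>n\<in>{2..N}. 2 * ln (real n) / real n ^ 2) \<le> 8"
proof -
  have step: "2 * ln (real (Suc n)) / real (Suc n) ^ 2 \<le> 8 / sqrt (real n) - 8 / sqrt (real (Suc n))" if n: "n > 0" for n
  proof -
    define u v where "u = sqrt (real n)" and "v = sqrt (real (Suc n))"
    have uv: "0 < u" "u \<le> v" "v\<^sup>2 = u\<^sup>2 + 1" "v\<^sup>2 = real (Suc n)" using n by (auto simp: u_def v_def)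
    have "(v - u) * (v + u) = 1" using uv by (simp add: power2_eq_square algebra_simps)
    hence vu: "v - u = 1 / (v + u)" using uv by (simp add: field_simps)
    have "8 / u - 8 / v = 8 * (v - u) / (u * v)" using uv by (simp add: field_simps)
    also have "\<dots> = 8 / ((v + u) * (u * v))" by (simp add: vu)
    also have "\<dots> \<ge> 8 / ((v + v) * (v * v))"
      using uv by (intro divide_left_mono mult_mono) auto
    finally have "4 / v ^ 3 \<le> 8 / u - 8 / v" by (simp add: power3_eq_cube)
    moreover have "2 * ln (real (Suc n)) / real (Suc n) ^ 2 \<le> 4 / v ^ 3"
    proof -
      have "2 * ln (real (Suc n)) / real (Suc n) ^ 2 \<le> 2 * (2 * v) / (v\<^sup>2) ^ 2"
        using ln_le_2_sqrt[of "real (Suc n)"] by (simp only: uv(4), intro divide_right_mono) (auto simp: v_def)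
      also have "\<dots> = 4 / v ^ 3" using uv(1,2) by (simp add: power2_eq_square power3_eq_cube)
      finally show ?thesis .
    qed
    ultimately show ?thesis by (simp add: u_def v_def)
  qed
  have "(\<Sum>n\<in>{2..Suc N}. 2 * ln (real n) / real n ^ 2) \<le> 8 - 8 / sqrt (real (Suc N))" for N
  proof (induction N)
    case (Suc N)
    thus ?case using step[of "Suc N"] by simp
  qed simp
  hence "(\<Sum>n\<in>{2..Suc N}. 2 * ln (real n) / real n ^ 2) \<le> 8 - 8 / sqrt (real (Suc N))" .
  also have "\<dots> \<le> 8" by simp
  moreover have "(\<Sum>n\<in>{2..N}. 2 * ln (real n) / real n ^ 2) \<le> (\<Sum>n\<in>{2..Suc N}. 2 * ln (real n) / real n ^ 2)"
    by (rule sum_mono2) auto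
  ultimately show ?thesis by linarith
qed

text \<open>Higher prime powers contribute a bounded amount, so logarithmic growth of a Mangoldt sum
  must come from primes.\<close>

lemma sum_mangoldt_nonprime_le:
  "(\<Sum>n\<in>{n\<in>{1..N}. \<not> prime n}. mangoldt n / real n) \<le> 8"
proof -
  have "(\<Sum>n\<in>{n\<in>{1..N}. \<not> prime n}. mangoldt n / real n) \<le> (\<Sum>n\<in>{2..N}. 2 * ln (real n) / real n ^ 2)"
  proof (rule sum_mangoldt_prime_powers_le)
    fix n assume n: "n \<in> {n\<in>{1..N}. \<not> prime n}" "primepow n"
    then obtain p k where pk: "prime p" "k > 0" "n = p ^ k" by (auto simp: primepow_def)
    with n have "k \<noteq> 1" by auto
    with pk have "k \<ge> 2" by simp
    moreover have "p \<le> N" using n pk by (metis (no_types, lifting) atLeastAtMost_iff dvd_imp_le dvd_power le_trans mem_Collect_eq prime_gt_0_nat zero_less_power)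
    ultimately show "\<exists>p\<in>{2..N}. \<exists>k\<ge>2. prime p \<and> n = p ^ k"
      using pk prime_ge_2_nat[of p] by auto
  qed auto
  also have "\<dots> \<le> 8" by (rule sum_ln_over_square_le)
  finally show ?thesis .
qed

lemma sum_mangoldt_not_coprime_le:
  assumes "m > 0"
  shows "(\<Sum>n\<in>{n\<in>{1..N}. \<not> coprime n m}. mangoldt n / real n) \<le> (\<Sum>p\<in>prime_factors m. 2 * ln (real p) / real p ^ 1)"
proof (rule sum_mangoldt_prime_powers_le)
  fix n assume n: "n \<in> {n\<in>{1..N}. \<not> coprime n m}" "primepow n"
  then obtain p k where pk: "prime p" "k > 0" "n = p ^ k" by (auto simp: primepow_def)
  with n have "p dvd m" by (auto dest: prime_imp_coprime)
  thus "\<exists>p\<in>prime_factors m. \<exists>k\<ge>1. prime p \<and> n = p ^ k"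
    using pk assms by (auto simp: in_prime_factors_iff intro!: exI[of _ k] bexI[of _ p])
qed (auto simp: in_prime_factors_iff prime_ge_2_nat)

section \<open>Dirichlet characters\<close>

text \<open>Characters of the unit group modulo \<open>m\<close>, extended by 0 to all naturals;
  this makes them completely multiplicative without any coprimality side condition.\<close>

definition dchars :: "nat \<Rightarrow> (nat \<Rightarrow> complex) set" where
  "dchars m = {\<chi>. (\<forall>x y. \<chi> (x * y) = \<chi> x * \<chi> y) \<and> (\<forall>x. \<chi> (x + m) = \<chi> x) \<and> (\<forall>x. \<chi> x \<noteq> 0 \<longleftrightarrow> coprime x m)}"

definition principal_dchar :: "nat \<Rightarrow> nat \<Rightarrow> complex" where
  "principal_dchar m x = (if coprime x m then 1 else 0)"

lemma dchar_mult: "\<chi> \<in> dchars m \<Longrightarrow> \<chi> (x * y) = \<chi> x * \<chi> y"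
  and dchar_add_modulus: "\<chi> \<in> dchars m \<Longrightarrow> \<chi> (x + m) = \<chi> x"
  and dchar_eq_0_iff: "\<chi> \<in> dchars m \<Longrightarrow> \<chi> x = 0 \<longleftrightarrow> \<not> coprime x m"
  unfolding dchars_def by blast+

lemma dchar_mod:
  assumes "\<chi> \<in> dchars m"
  shows "\<chi> (x mod m) = \<chi> x"
proof -
  have "\<chi> (r + q * m) = \<chi> r" for r q
  proof (induction q)
    case (Suc q)
    thus ?case using dchar_add_modulus[OF assms, of "r + q * m"] by (simp add: algebra_simps)
  qed simp
  from this[of "x mod m" "x div m"] show ?thesis by simp
qed

lemma dchar_cong: "\<chi> \<in> dchars m \<Longrightarrow> [x = y] (mod m) \<Longrightarrow> \<chi> x = \<chi> y"
  by (metis dchar_mod unique_euclidean_semiring_class.cong_def)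

lemma dchar_1 [simp]:
  assumes "\<chi> \<in> dchars m"
  shows "\<chi> (Suc 0) = 1"
  using dchar_mult[OF assms, of 1 1] dchar_eq_0_iff[OF assms, of 1] by auto

lemma dchar_power: "\<chi> \<in> dchars m \<Longrightarrow> \<chi> (x ^ k) = \<chi> x ^ k"
  by (induction k) (auto simp: dchar_mult)

lemma dchar_power_totient:
  assumes "\<chi> \<in> dchars m" "coprime x m"
  shows "\<chi> x ^ totient m = 1"
  using dchar_cong[OF assms(1) euler_theorem[OF assms(2)]] assms by (simp add: dchar_power)

lemma norm_dchar:
  assumes "\<chi> \<in> dchars m" "m > 0"
  shows "norm (\<chi> x) = (if coprime x m then 1 else 0)"
proof (cases "coprime x m")
  case True
  have "norm (\<chi> x) ^ totient m = 1 ^ totient m"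
    using dchar_power_totient[OF assms(1) True] by (metis norm_power norm_one power_one)
  hence "norm (\<chi> x) = 1" by (rule power_eq_imp_eq_base) (use assms(2) in auto)
  thus ?thesis using True by simp
qed (use assms dchar_eq_0_iff in auto)

lemma norm_dchar_le: "\<chi> \<in> dchars m \<Longrightarrow> m > 0 \<Longrightarrow> norm (\<chi> x) \<le> 1"
  by (simp add: norm_dchar)

text \<open>A character is determined by its values below \<open>m\<close>, and each value is 0 or a
  root of unity of order dividing \<open>totient m\<close>.\<close>

lemma finite_dchars:
  assumes "m > 0"
  shows "finite (dchars m)"
proof -
  define V where "V = insert 0 {z :: complex. z ^ totient m = 1}"
  have "finite V" using assms by (auto simp: V_def Suc_le_eq intro!: finite_roots_unity)
  hence fin: "finite ({..<m} \<rightarrow>\<^sub>E V)" by (intro finite_PiE) auto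
  have "inj_on (\<lambda>\<chi>. restrict \<chi> {..<m}) (dchars m)"
  proof (rule inj_onI)
    fix \<chi> \<psi> assume *: "\<chi> \<in> dchars m" "\<psi> \<in> dchars m" "restrict \<chi> {..<m} = restrict \<psi> {..<m}"
    show "\<chi> = \<psi>"
    proof
      fix x
      have "\<chi> (x mod m) = \<psi> (x mod m)"
        using fun_cong[OF *(3), of "x mod m"] assms by simp
      thus "\<chi> x = \<psi> x" using * by (simp add: dchar_mod)
    qed
  qed
  moreover have "(\<lambda>\<chi>. restrict \<chi> {..<m}) ` dchars m \<subseteq> {..<m} \<rightarrow>\<^sub>E V"
  proof (intro image_subsetI)
    fix \<chi> assume \<chi>: "\<chi> \<in> dchars m"
    show "restrict \<chi> {..<m} \<in> {..<m} \<rightarrow>\<^sub>E V"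
      unfolding restrict_PiE_iff V_def
      using dchar_power_totient[OF \<chi>] dchar_eq_0_iff[OF \<chi>] by blast
  qed
  ultimately show ?thesis using fin by (metis finite_imageD finite_subset)
qed

lemma principal_dchar_in_dchars: "principal_dchar m \<in> dchars m"
proof -
  have "coprime (x + m) m \<longleftrightarrow> coprime x m" for x by (metis coprime_iff_gcd_eq_1 gcd_add1)
  thus ?thesis by (auto simp: dchars_def principal_dchar_def)
qed

lemma cnj_dchar: "\<chi> \<in> dchars m \<Longrightarrow> (\<lambda>x. cnj (\<chi> x)) \<in> dchars m"
  unfolding dchars_def by simp

lemma times_dchar: "\<chi> \<in> dchars m \<Longrightarrow> \<psi> \<in> dchars m \<Longrightarrow> (\<lambda>x. \<chi> x * \<psi> x) \<in> dchars m"
  unfolding dchars_def by simp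

section \<open>Separating characters and orthogonality\<close>

lemma sum_inverse_powers_roots_of_unity:
  assumes "j < n"
  shows "(\<Sum>l<n. 1 / cis (2 * pi * real l / real n) ^ j) = (if j = 0 then of_nat n else 0)"
proof (cases "j = 0")
  case False
  define z where "z = 1 / cis (2 * pi * real j / real n)"
  have "cis (2 * pi * real j / real n) \<noteq> cis (2 * pi * real 0 / real n)"
    using bij_betw_roots_unity[of n] assms False by (auto simp: bij_betw_def dest!: inj_onD[of _ _ j 0])
  hence z1: "z \<noteq> 1" by (auto simp: z_def)
  have zn: "z ^ n = 1" using assms by (simp add: z_def power_divide DeMoivre)
  have "(\<Sum>l<n. 1 / cis (2 * pi * real l / real n) ^ j) = (\<Sum>l<n. z ^ l)"
    by (intro sum.cong refl) (simp add: z_def power_divide DeMoivre mult_ac)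
  also have "\<dots> = 0" using z1 zn by (simp add: geometric_sum)
  finally show ?thesis using False by simp
qed simp

text \<open>A discrete Fourier transform along the orbits of multiplication by \<open>g\<close>. By
  Euler's theorem the \<open>n\<close>-th power of this translation is the identity, so shifting
  \<open>j\<close> is cyclic and \<open>P l\<close> is \<open>n\<close> times the projection of
  \<open>f\<close> to the eigenspace of the root of unity \<open>w l\<close>.\<close>

lemma translation_eigenfunction_decomposition:
  fixes f :: "nat \<Rightarrow> complex"
  assumes m: "m > 0" and g: "coprime g m"
    and per: "\<And>x y. [x = y] (mod m) \<Longrightarrow> f x = f y"
  defines "n \<equiv> totient m"
  defines "w \<equiv> \<lambda>l. cis (2 * pi * real l / real n)"
  defines "P \<equiv> \<lambda>l x. \<Sum>j<n. f (g ^ j * x) / w l ^ j"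
  shows "P l (g * x) = w l * P l x" and "(\<Sum>l<n. P l x) = of_nat n * f x"
proof -
  have n: "n > 0" using m by (simp add: n_def)
  define h where "h = (\<lambda>j. f (g ^ j * x) / w l ^ j)"
  have "w l ^ n = 1" using n by (simp add: w_def DeMoivre)
  moreover have "f (g ^ n * x) = f x"
    using euler_theorem[OF g] by (intro per) (metis cong_scalar_right mult_1 n_def)
  ultimately have hn: "h n = h 0" by (simp add: h_def)
  have "P l (g * x) = (\<Sum>j<n. w l * h (Suc j))"
    unfolding P_def h_def by (intro sum.cong refl) (simp add: w_def mult_ac)
  also have "\<dots> = w l * (\<Sum>j<n. h (Suc j))" by (simp add: sum_distrib_left)
  also have "(\<Sum>j<n. h (Suc j)) = (\<Sum>j<n. h j)"
    using sum.lessThan_Suc_shift[of h n] hn by simp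
  finally show "P l (g * x) = w l * P l x" by (simp add: P_def h_def)
  have "(\<Sum>l<n. P l x) = (\<Sum>j<n. \<Sum>l<n. f (g ^ j * x) / w l ^ j)"
    unfolding P_def by (rule sum.swap)
  also have "\<dots> = (\<Sum>j<n. f (g ^ j * x) * (\<Sum>l<n. 1 / w l ^ j))"
    by (simp add: sum_distrib_left)
  also have "\<dots> = (\<Sum>j<n. if j = 0 then of_nat n * f x else 0)"
    by (intro sum.cong refl) (auto simp: w_def sum_inverse_powers_roots_of_unity)
  also have "\<dots> = of_nat n * f x" using n by simp
  finally show "(\<Sum>l<n. P l x) = of_nat n * f x" .
qed

text \<open>The translations commute, so projecting to an eigenspace of a further \<open>g\<close>
  preserves every eigenvalue relation already obtained, including the prescribed one for
  \<open>a\<close>. The projections add up to a nonzero multiple of the old function, hence one of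
  them is nonzero.\<close>

lemma exists_simultaneous_eigenfunction:
  fixes f0 :: "nat \<Rightarrow> complex"
  assumes m: "m > 0" and "finite G" and "\<And>g. g \<in> G \<Longrightarrow> coprime g m"
    and "\<And>x y. [x = y] (mod m) \<Longrightarrow> f0 x = f0 y"
    and "\<And>x. f0 x \<noteq> 0 \<Longrightarrow> coprime x m"
    and "\<exists>x. f0 x \<noteq> 0"
    and "\<And>x. f0 (a * x) = \<omega> * f0 x"
  shows "\<exists>f. (\<forall>x y. [x = y] (mod m) \<longrightarrow> f x = f y) \<and> (\<forall>x. f x \<noteq> 0 \<longrightarrow> coprime x m) \<and>
     (\<exists>x. f x \<noteq> 0) \<and> (\<forall>x. f (a * x) = \<omega> * f x) \<and> (\<forall>g\<in>G. \<exists>c. \<forall>x. f (g * x) = c * f x)"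
  using assms(2,3)
proof (induction G rule: finite_induct)
  case empty
  show ?case using assms by (intro exI[of _ f0]) blast
next
  case (insert g G)
  have "\<And>g. g \<in> G \<Longrightarrow> coprime g m" using insert.prems by blast
  from insert.IH[OF this] obtain f where f: "\<And>x y. [x = y] (mod m) \<Longrightarrow> f x = f y" "\<And>x. f x \<noteq> 0 \<Longrightarrow> coprime x m"
     "\<exists>x. f x \<noteq> 0" "\<And>x. f (a * x) = \<omega> * f x" "\<And>h. h \<in> G \<Longrightarrow> \<exists>c. \<forall>x. f (h * x) = c * f x"
    by blast
  have g: "coprime g m" using insert.prems by blast
  define n where "n = totient m"
  define w where "w = (\<lambda>l. cis (2 * pi * real l / real n))"
  define P where "P = (\<lambda>l x. \<Sum>j<n. f (g ^ j * x) / w l ^ j)"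
  have P1: "P l (g * x) = w l * P l x" for l x
    using translation_eigenfunction_decomposition(1)[OF m g, of f x l] f(1)
    unfolding P_def w_def n_def by blast
  have P2: "(\<Sum>l<n. P l x) = of_nat n * f x" for x
    using translation_eigenfunction_decomposition(2)[OF m g, of f x] f(1)
    unfolding P_def w_def n_def by blast
  have eig: "P l (h * x) = c * P l x" if "\<And>x. f (h * x) = c * f x" for l h c x
  proof -
    have "f (g ^ j * (h * x)) = c * f (g ^ j * x)" for j
      using that[of "g ^ j * x"] by (simp add: mult_ac)
    thus ?thesis by (simp add: P_def sum_distrib_left)
  qed
  obtain x0 where "f x0 \<noteq> 0" using f(3) by auto
  moreover have "n > 0" using m by (simp add: n_def)
  ultimately have "(\<Sum>l<n. P l x0) \<noteq> 0" by (simp add: P2)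
  then obtain l where l: "P l x0 \<noteq> 0" by (meson sum.not_neutral_contains_not_neutral)
  show ?case
  proof (intro exI[of _ "P l"] conjI allI impI ballI)
    fix x y :: nat assume "[x = y] (mod m)"
    thus "P l x = P l y" unfolding P_def
      by (intro sum.cong refl arg_cong2[where f = "(/)"] f(1) cong_scalar_left)
  next
    fix x assume "P l x \<noteq> 0"
    then obtain j where "f (g ^ j * x) \<noteq> 0"
      unfolding P_def by (metis (no_types, lifting) div_0 sum.neutral)
    thus "coprime x m" using f(2) by fastforce
  next
    show "\<exists>x. P l x \<noteq> 0" using l by blast
    show "P l (a * x) = \<omega> * P l x" for x by (rule eig) (rule f(4))
    show "\<exists>c. \<forall>x. P l (h * x) = c * P l x" if "h \<in> insert g G" for h
      using that P1 f(5) eig by (metis insert_iff)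
  qed
qed

text \<open>Translation by a nontrivial unit has an eigenvalue other than 1 on the functions on the unit
  group; a simultaneous eigenfunction of all translations inside that eigenspace is, up to scaling,
  a separating character.\<close>

lemma dchar_separates:
  assumes m: "m > 1" and a: "coprime a m" "\<not> [a = 1] (mod m)"
  obtains \<chi> where "\<chi> \<in> dchars m" "\<chi> a \<noteq> 1"
proof -
  have m0: "m > 0" using m by simp
  define n where "n = totient m"
  define w where "w = (\<lambda>l. cis (2 * pi * real l / real n))"
  define \<delta> :: "nat \<Rightarrow> complex" where "\<delta> = (\<lambda>x. if [x = 1] (mod m) then 1 else 0)"
  define P where "P = (\<lambda>l x. \<Sum>j<n. \<delta> (a ^ j * x) / w l ^ j)"
  have per: "\<delta> x = \<delta> y" if "[x = y] (mod m)" for x y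
    using that by (auto simp: \<delta>_def unique_euclidean_semiring_class.cong_def)
  have P1: "P l (a * x) = w l * P l x" for l x
    using translation_eigenfunction_decomposition(1)[OF m0 a(1), of \<delta> x l] per
    unfolding P_def w_def n_def by blast
  have P2: "(\<Sum>l<n. P l x) = of_nat n * \<delta> x" for x
    using translation_eigenfunction_decomposition(2)[OF m0 a(1), of \<delta> x] per
    unfolding P_def w_def n_def by blast
  have n: "n > 0" using m by (simp add: n_def)
  \<comment> \<open>If only the eigenvalue 1 occurred, the indicator \<open>\<delta>\<close> of the
    class of 1 would be invariant under translation by \<open>a\<close>, which moves that
    class.\<close>
  have "\<exists>l. w l \<noteq> 1 \<and> (\<exists>x. P l x \<noteq> 0)"
  proof (rule ccontr)
    assume "\<not> ?thesis"
    hence *: "P l (a * x) = P l x" for l x using P1 by fastforce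
    have "of_nat n * \<delta> (a * 1) = of_nat n * \<delta> 1" unfolding P2 [symmetric] * ..
    thus False using a(2) n by (simp add: \<delta>_def split: if_splits)
  qed
  then obtain l where l: "w l \<noteq> 1" "\<exists>x. P l x \<noteq> 0" by blast
  define G where "G = {g\<in>{..<m}. coprime g m}"
  have "\<exists>f. (\<forall>x y. [x = y] (mod m) \<longrightarrow> f x = f y) \<and> (\<forall>x. f x \<noteq> 0 \<longrightarrow> coprime x m) \<and>
     (\<exists>x. f x \<noteq> 0) \<and> (\<forall>x. f (a * x) = w l * f x) \<and> (\<forall>g\<in>G. \<exists>c. \<forall>x. f (g * x) = c * (f x :: complex))"
  proof (rule exists_simultaneous_eigenfunction[where ?f0.0 = "P l"])
    fix x y :: nat assume "[x = y] (mod m)"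
    thus "P l x = P l y" unfolding P_def
      by (intro sum.cong refl arg_cong2[where f = "(/)"] per cong_scalar_left)
  next
    fix x assume "P l x \<noteq> 0"
    then obtain j where "\<delta> (a ^ j * x) \<noteq> 0"
      unfolding P_def by (metis (no_types, lifting) div_0 sum.neutral)
    hence "[a ^ j * x = 1] (mod m)" by (auto simp: \<delta>_def split: if_splits)
    hence "coprime (a ^ j * x) m" using cong_imp_coprime cong_sym coprime_1_left by blast
    thus "coprime x m" by simp
  qed (use l P1 m0 in \<open>auto simp: G_def\<close>)
  then obtain f where f: "\<And>x y. [x = y] (mod m) \<Longrightarrow> f x = f y" "\<And>x. f x \<noteq> (0::complex) \<Longrightarrow> coprime x m"
     "\<exists>x. f x \<noteq> 0" "\<And>x. f (a * x) = w l * f x" "\<And>h. h \<in> G \<Longrightarrow> \<exists>c. \<forall>x. f (h * x) = c * f x"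
    by blast
  obtain x0 where x0: "f x0 \<noteq> 0" using f(3) by blast
  \<comment> \<open>The eigenvalue of translation by \<open>g\<close>, read off at a point
    \<open>x0\<close> where \<open>f\<close> does not vanish.\<close>
  define \<chi> where "\<chi> = (\<lambda>g. if coprime g m then f (g * x0) / f x0 else 0)"
  have eig: "f (g * x) = \<chi> g * f x" if g: "coprime g m" for g x
  proof -
    have "g mod m \<in> G" using g m by (simp add: G_def)
    then obtain c where c: "\<And>x. f (g mod m * x) = c * f x" using f(5) by blast
    have "f (g * x) = f (g mod m * x)" for x
      by (rule f(1)) (simp add: unique_euclidean_semiring_class.cong_def mod_mult_left_eq)
    hence *: "f (g * x) = c * f x" for x using c by simp
    show ?thesis using x0 g by (simp add: \<chi>_def *)
  qed
  have "\<chi> \<in> dchars m"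
    unfolding dchars_def
  proof (intro CollectI conjI allI)
    fix x y
    show "\<chi> (x * y) = \<chi> x * \<chi> y"
    proof (cases "coprime x m \<and> coprime y m")
      case True
      hence "f (x * (y * x0)) = \<chi> x * (\<chi> y * f x0)" by (simp add: eig)
      thus ?thesis using True x0 by (simp add: \<chi>_def mult.assoc)
    qed (auto simp: \<chi>_def)
    have "f ((x + m) * x0) = f (x * x0)"
      by (rule f(1)) (simp add: unique_euclidean_semiring_class.cong_def algebra_simps)
    moreover have "coprime (x + m) m \<longleftrightarrow> coprime x m" by (metis coprime_iff_gcd_eq_1 gcd_add1)
    ultimately show "\<chi> (x + m) = \<chi> x" by (simp add: \<chi>_def)
    show "\<chi> x \<noteq> 0 \<longleftrightarrow> coprime x m"
    proof (cases "coprime x m")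
      case True
      then obtain y where y: "[x * y = 1] (mod m)" using cong_solve_coprime_nat by auto
      have "f (x * (y * x0)) = f x0"
        by (rule f(1)) (use y in \<open>metis cong_scalar_right mult.assoc mult_1\<close>)
      hence "\<chi> x * f (y * x0) = f x0" by (simp add: eig True)
      thus ?thesis using True x0 by auto
    qed (simp add: \<chi>_def)
  qed
  moreover have "\<chi> a = w l" using a(1) x0 by (simp add: \<chi>_def f(4))
  ultimately show ?thesis using l(1) that by metis
qed

text \<open>Multiplication by a character \<open>\<psi>\<close> with
  \<open>\<psi> a \<noteq> 1\<close> permutes the characters, so the sum equals
  \<open>\<psi> a\<close> times itself. It is injective because all characters vanish at the same
  arguments.\<close>

lemma sum_dchars_eq_0:
  assumes m: "m > 1" and a: "coprime a m" "\<not> [a = 1] (mod m)"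
  shows "(\<Sum>\<chi>\<in>dchars m. \<chi> a) = 0"
proof -
  obtain \<psi> where \<psi>: "\<psi> \<in> dchars m" "\<psi> a \<noteq> 1" using dchar_separates[OF assms] .
  have fin: "finite (dchars m)" using m by (simp add: finite_dchars)
  define T where "T = (\<lambda>(\<chi> :: nat \<Rightarrow> complex) x. \<psi> x * \<chi> x)"
  have inj: "inj_on T (dchars m)"
  proof (rule inj_onI)
    fix \<chi> \<chi>' assume *: "\<chi> \<in> dchars m" "\<chi>' \<in> dchars m" "T \<chi> = T \<chi>'"
    show "\<chi> = \<chi>'"
    proof
      fix x
      show "\<chi> x = \<chi>' x"
        using fun_cong[OF *(3), of x] dchar_eq_0_iff[OF \<psi>(1), of x] dchar_eq_0_iff[OF *(1), of x]
          dchar_eq_0_iff[OF *(2), of x] by (cases "coprime x m") (auto simp: T_def)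
    qed
  qed
  have "T ` dchars m \<subseteq> dchars m" using times_dchar[OF \<psi>(1)] by (auto simp: T_def)
  hence "T ` dchars m = dchars m" using endo_inj_surj[OF fin _ inj] by blast
  hence "(\<Sum>\<chi>\<in>dchars m. \<chi> a) = (\<Sum>\<chi>\<in>T ` dchars m. \<chi> a)" by simp
  also have "\<dots> = \<psi> a * (\<Sum>\<chi>\<in>dchars m. \<chi> a)"
    using inj by (subst sum.reindex) (auto simp: T_def sum_distrib_left)
  finally show ?thesis using \<psi>(2) by simp
qed

text \<open>Conjugating a value of modulus 1 inverts it, so \<open>cnj (\<chi> r)\<close> is
  \<open>\<chi> s\<close> for an inverse \<open>s\<close> of \<open>r\<close>, and the sum becomes
  one over \<open>\<chi> (s * n)\<close>.\<close>

lemma dchars_orthogonality: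
  assumes m: "m > 1" and r: "coprime r m"
  shows "(\<Sum>\<chi>\<in>dchars m. cnj (\<chi> r) * \<chi> n) = (if [n = r] (mod m) then of_nat (card (dchars m)) else 0)"
proof (cases "coprime n m")
  case False
  hence "\<not> [n = r] (mod m)" using r by (metis cong_imp_coprime cong_sym)
  moreover have "(\<Sum>\<chi>\<in>dchars m. cnj (\<chi> r) * \<chi> n) = 0"
    using False by (intro sum.neutral) (auto simp: dchar_eq_0_iff)
  ultimately show ?thesis by simp
next
  case True
  obtain s where s: "[r * s = 1] (mod m)" using cong_solve_coprime_nat[OF r] by auto
  have sm: "coprime s m" using s by (metis cong_imp_coprime cong_sym coprime_1_left coprime_mult_left_iff)
  have cs: "cnj (\<chi> r) = \<chi> s" if \<chi>: "\<chi> \<in> dchars m" for \<chi>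
  proof -
    have "\<chi> r * \<chi> s = 1" using dchar_cong[OF \<chi> s] \<chi> by (simp add: dchar_mult)
    moreover have "\<chi> r * cnj (\<chi> r) = 1"
      using norm_dchar[OF \<chi>, of r] m r by (simp add: complex_norm_square [symmetric])
    ultimately show ?thesis by (metis mult_cancel_left mult_zero_left zero_neq_one)
  qed
  have "(\<Sum>\<chi>\<in>dchars m. cnj (\<chi> r) * \<chi> n) = (\<Sum>\<chi>\<in>dchars m. \<chi> (s * n))"
    by (intro sum.cong refl) (simp add: cs dchar_mult)
  moreover have "[s * n = 1] (mod m) \<longleftrightarrow> [n = r] (mod m)"
  proof
    assume "[s * n = 1] (mod m)"
    hence "[r * (s * n) = r * 1] (mod m)" by (rule cong_scalar_left)
    moreover have "[(r * s) * n = 1 * n] (mod m)" using s by (rule cong_scalar_right)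
    ultimately show "[n = r] (mod m)" by (metis cong_sym cong_trans mult.assoc mult_1 mult_1_right)
  next
    assume "[n = r] (mod m)"
    hence "[s * n = s * r] (mod m)" by (rule cong_scalar_left)
    thus "[s * n = 1] (mod m)" using s by (metis cong_trans mult.commute)
  qed
  moreover have "(\<Sum>\<chi>\<in>dchars m. \<chi> (s * n)) = of_nat (card (dchars m))" if "[s * n = 1] (mod m)"
    using that by (simp add: dchar_cong[OF _ that])
  moreover have "coprime (s * n) m" using sm True by simp
  ultimately show ?thesis using sum_dchars_eq_0[OF m, of "s * n"] by auto
qed

section \<open>Character sums weighted by the Mangoldt function\<close>

text \<open>Summation by parts: the weights of the partial sums become the nonnegative decrements of
  \<open>f\<close> and the final value \<open>f b\<close>, which telescope to
  \<open>f a\<close>.\<close>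

lemma abel_summation_bound:
  fixes c :: "nat \<Rightarrow> complex" and f :: "nat \<Rightarrow> real"
  assumes C: "\<And>b. norm (\<Sum>n\<in>{a..<b}. c n) \<le> C"
    and anti: "\<And>n. n \<ge> a \<Longrightarrow> f (Suc n) \<le> f n" and nonneg: "\<And>n. n \<ge> a \<Longrightarrow> f n \<ge> 0"
  shows "norm (\<Sum>n\<in>{a..<b}. c n * of_real (f n)) \<le> C * f a"
proof (cases "a \<le> b")
  case True
  define P where "P = (\<lambda>b. \<Sum>n\<in>{a..<b}. c n)"
  have eq: "(\<Sum>n\<in>{a..<b}. c n * of_real (f n))
      = P b * of_real (f b) + (\<Sum>n\<in>{a..<b}. P (Suc n) * of_real (f n - f (Suc n)))"
    using True
  proof (induction b rule: dec_induct)
    case (step b)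
    thus ?case by (simp add: P_def algebra_simps)
  qed (simp add: P_def)
  have "norm (\<Sum>n\<in>{a..<b}. c n * of_real (f n))
      \<le> norm (P b * of_real (f b)) + (\<Sum>n\<in>{a..<b}. norm (P (Suc n) * of_real (f n - f (Suc n))))"
    unfolding eq by (intro order_trans[OF norm_triangle_ineq] add_left_mono norm_sum)
  also have "\<dots> \<le> C * f b + (\<Sum>n\<in>{a..<b}. C * (f n - f (Suc n)))"
  proof (intro add_mono sum_mono)
    show "norm (P b * of_real (f b)) \<le> C * f b"
      using C[of b] nonneg[OF True] by (auto simp: norm_mult P_def intro!: mult_right_mono)
    fix n assume n: "n \<in> {a..<b}"
    have "norm (P (Suc n) * of_real (f n - f (Suc n))) = norm (P (Suc n)) * (f n - f (Suc n))"
      using anti[of n] n by (simp only: norm_mult norm_of_real) simp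
    also have "\<dots> \<le> C * (f n - f (Suc n))"
      using C[of "Suc n"] anti[of n] n by (intro mult_right_mono) (auto simp: P_def)
    finally show "norm (P (Suc n) * of_real (f n - f (Suc n))) \<le> C * (f n - f (Suc n))" .
  qed
  also have "(\<Sum>n\<in>{a..<b}. C * (f n - f (Suc n))) = C * (f a - f b)"
    using True by (induction b rule: dec_induct) (auto simp: algebra_simps)
  finally show ?thesis by (simp add: algebra_simps)
next
  case False
  have "0 \<le> C" using C[of a] by simp
  thus ?thesis using False nonneg[of a] by simp
qed

definition mangoldt_char_sum :: "(nat \<Rightarrow> complex) \<Rightarrow> nat \<Rightarrow> complex" where
  "mangoldt_char_sum \<chi> N = (\<Sum>n\<in>{1..N}. \<chi> n * mangoldt n / of_nat n)"

text \<open>The terms dropped from the Mertens sum are powers of the finitely many primes dividing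
  \<open>m\<close>, and their contribution is bounded independently of \<open>N\<close>.\<close>

lemma mangoldt_principal_char_sum:
  assumes "m > 0"
  shows "\<exists>B. \<forall>N>0. norm (mangoldt_char_sum (principal_dchar m) N - of_real (ln (real N))) \<le> B"
proof (intro exI allI impI)
  fix N :: nat assume N: "N > 0"
  define Q where "Q = (\<Sum>p\<in>prime_factors m. 2 * ln (real p) / real p ^ 1)"
  define R where "R = (\<Sum>n\<in>{n\<in>{1..N}. \<not> coprime n m}. mangoldt n / real n :: real)"
  define M where "M = (\<Sum>n\<in>{1..N}. mangoldt n / real n :: real)"
  have eq: "mangoldt_char_sum (principal_dchar m) N = of_real (M - R)"
  proof -
    have "M = (\<Sum>n\<in>{n\<in>{1..N}. coprime n m} \<union> {n\<in>{1..N}. \<not> coprime n m}. mangoldt n / real n)"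
      unfolding M_def by (rule sum.cong) auto
    also have "\<dots> = (\<Sum>n\<in>{n\<in>{1..N}. coprime n m}. mangoldt n / real n) + R"
      unfolding R_def by (rule sum.union_disjoint) auto
    finally have "M - R = (\<Sum>n\<in>{n\<in>{1..N}. coprime n m}. mangoldt n / real n)" by simp
    also have "of_real \<dots> = (\<Sum>n\<in>{n\<in>{1..N}. coprime n m}. mangoldt n / of_nat n :: complex)"
      by simp
    also have "\<dots> = mangoldt_char_sum (principal_dchar m) N"
      unfolding mangoldt_char_sum_def
      by (rule sum.mono_neutral_cong_left) (auto simp: principal_dchar_def)
    finally show ?thesis ..
  qed
  have "R \<ge> 0" unfolding R_def by (intro sum_nonneg) (auto simp: mangoldt_nonneg)
  moreover have "R \<le> Q" unfolding R_def Q_def by (rule sum_mangoldt_not_coprime_le) fact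
  moreover have "\<bar>M - ln (real N)\<bar> \<le> 4" unfolding M_def by (rule mertens_mangoldt) fact
  ultimately have "\<bar>M - R - ln (real N)\<bar> \<le> 4 + Q" by linarith
  thus "norm (mangoldt_char_sum (principal_dchar m) N - of_real (ln (real N))) \<le> 4 + Q"
    unfolding eq of_real_diff [symmetric] norm_of_real .
qed

lemma ln_over_self_antimono:
  assumes "n \<ge> 3"
  shows "ln (real (Suc n)) / real (Suc n) \<le> ln (real n) / real n"
proof -
  have "exp 1 \<le> real n" using assms exp_le by linarith
  hence 1: "1 \<le> ln (real n)" using assms by (subst ln_ge_iff) auto
  have "1 + 1 / real n = real (Suc n) / real n" using assms by (simp add: field_simps)
  hence "ln (real (Suc n)) - ln (real n) = ln (1 + 1 / real n)"
    using assms by (simp add: ln_div)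
  also have "\<dots> \<le> 1 / real n" by (rule ln_add_one_self_le_self) auto
  finally have "real n * (ln (real (Suc n)) - ln (real n)) \<le> 1"
    using assms by (simp add: field_simps)
  hence "real n * ln (real (Suc n)) \<le> real (Suc n) * ln (real n)"
    using 1 by (simp add: algebra_simps)
  thus ?thesis using assms by (simp add: field_simps)
qed

text \<open>The term at \<open>n = 0\<close> is a division by zero, hence 0, so this is the usual
  series starting at 1.\<close>

definition dirichlet_L1 :: "(nat \<Rightarrow> complex) \<Rightarrow> complex" where
  "dirichlet_L1 \<chi> = (\<Sum>n. \<chi> n / of_nat n)"

locale nonprincipal_dchar =
  fixes m :: nat and \<chi> :: "nat \<Rightarrow> complex"
  assumes modulus: "m > 1" and dchar: "\<chi> \<in> dchars m" and nonprincipal: "\<chi> \<noteq> principal_dchar m"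
begin

text \<open>Multiplication by a unit \<open>a\<close> with \<open>\<chi> a \<noteq> 1\<close>
  permutes the residues and scales the sum by \<open>\<chi> a\<close>.\<close>

lemma sum_period: "(\<Sum>n<m. \<chi> n) = 0"
proof -
  obtain a where a: "\<chi> a \<noteq> principal_dchar m a" using nonprincipal by auto
  hence am: "coprime a m" and a1: "\<chi> a \<noteq> 1"
    using dchar_eq_0_iff[OF dchar, of a] by (auto simp: principal_dchar_def split: if_splits)
  have inj: "inj_on (\<lambda>x. (a * x) mod m) {..<m}"
  proof (rule inj_onI)
    fix x y assume "x \<in> {..<m}" "y \<in> {..<m}" "(a * x) mod m = (a * y) mod m"
    thus "x = y"
      using cong_mult_lcancel_nat[OF am, of x y] by (auto simp: unique_euclidean_semiring_class.cong_def)
  qed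
  have "(\<lambda>x. (a * x) mod m) ` {..<m} \<subseteq> {..<m}" using modulus by auto
  hence img: "(\<lambda>x. (a * x) mod m) ` {..<m} = {..<m}" using endo_inj_surj[OF _ _ inj] by blast
  have "(\<Sum>n<m. \<chi> n) = (\<Sum>n\<in>(\<lambda>x. (a * x) mod m) ` {..<m}. \<chi> n)" by (simp only: img)
  also have "\<dots> = (\<Sum>n<m. \<chi> a * \<chi> n)"
    by (subst sum.reindex[OF inj]) (simp add: dchar_mod[OF dchar] dchar_mult[OF dchar])
  finally show ?thesis using a1 by (simp add: sum_distrib_left [symmetric])
qed

lemma norm_le: "norm (\<chi> n) \<le> 1"
  using norm_dchar_le[OF dchar] modulus by simp

lemma norm_partial_sum_le: "norm (\<Sum>n<K. \<chi> n) \<le> real m"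
proof (induction K rule: less_induct)
  case (less K)
  have shift: "(\<Sum>n<m + K. \<chi> n) = (\<Sum>n<K. \<chi> n)" for K
    by (induction K) (simp_all add: sum_period dchar_add_modulus[OF dchar] add.commute[of m])
  show ?case
  proof (cases "K < m")
    case True
    have "norm (\<Sum>n<K. \<chi> n) \<le> (\<Sum>n<K. 1)"
      by (rule order_trans[OF norm_sum]) (intro sum_mono norm_le)
    thus ?thesis using True by simp
  next
    case False
    thus ?thesis using less[of "K - m"] shift[of "K - m"] modulus by simp
  qed
qed

lemma norm_interval_sum_le: "norm (\<Sum>n\<in>{a..<b}. \<chi> n) \<le> 2 * real m"
proof (cases "a \<le> b")
  case True
  have "(\<Sum>n\<in>{a..<b}. \<chi> n) = (\<Sum>n<b. \<chi> n) - (\<Sum>n<a. \<chi> n)"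
    using True by (simp add: sum_diff_nat_ivl[of 0 a b, symmetric] atLeast0LessThan)
  thus ?thesis using norm_triangle_ineq4[of "\<Sum>n<b. \<chi> n" "\<Sum>n<a. \<chi> n"]
      norm_partial_sum_le[of a] norm_partial_sum_le[of b] by simp
qed simp

lemma norm_weighted_sum_le:
  fixes f :: "nat \<Rightarrow> real"
  assumes "\<And>n. n \<ge> a \<Longrightarrow> f (Suc n) \<le> f n" "\<And>n. n \<ge> a \<Longrightarrow> f n \<ge> 0"
  shows "norm (\<Sum>n\<in>{a..<b}. \<chi> n * of_real (f n)) \<le> 2 * real m * f a"
  by (rule abel_summation_bound[where c = \<chi> and f = f, OF norm_interval_sum_le assms])

abbreviation "L1 \<equiv> dirichlet_L1 \<chi>"

lemma norm_tail_le:
  assumes "a > 0"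
  shows "norm (\<Sum>n\<in>{a..<b}. \<chi> n / of_nat n) \<le> 2 * real m / real a"
proof -
  have "norm (\<Sum>n\<in>{a..<b}. \<chi> n * of_real (1 / real n)) \<le> 2 * real m * (1 / real a)"
    by (rule norm_weighted_sum_le) (use assms in \<open>auto intro!: divide_left_mono\<close>)
  thus ?thesis by simp
qed

lemma summable_L1: "summable (\<lambda>n. \<chi> n / of_nat n)"
  unfolding summable_Cauchy
proof (intro allI impI)
  fix e :: real assume e: "e > 0"
  obtain N :: nat where N: "real N > 2 * real m / e" using reals_Archimedean2 by blast
  have "2 * real m / e > 0" using e modulus by simp
  hence N0: "N > 0" using N by linarith
  show "\<exists>N. \<forall>a\<ge>N. \<forall>b. norm (\<Sum>n\<in>{a..<b}. \<chi> n / of_nat n) < e"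
  proof (intro exI[of _ N] allI impI)
    fix a b assume a: "a \<ge> N"
    have "norm (\<Sum>n\<in>{a..<b}. \<chi> n / of_nat n) \<le> 2 * real m / real a"
      using norm_tail_le[of a b] a N0 by simp
    also have "\<dots> \<le> 2 * real m / real N" using a N0 by (intro divide_left_mono) auto
    also have "\<dots> < e" using N e N0 by (simp add: field_simps)
    finally show "norm (\<Sum>n\<in>{a..<b}. \<chi> n / of_nat n) < e" .
  qed
qed

lemma norm_L1_minus_partial_le:
  "norm (L1 - (\<Sum>n\<in>{1..N}. \<chi> n / of_nat n)) \<le> 2 * real m / (real N + 1)"
proof (rule LIMSEQ_le_const2)
  have "(\<lambda>K. \<Sum>n<K. \<chi> n / of_nat n) \<longlonglongrightarrow> L1"
    unfolding dirichlet_L1_def by (rule summable_LIMSEQ) (rule summable_L1)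
  thus "(\<lambda>K. norm ((\<Sum>n<K. \<chi> n / of_nat n) - (\<Sum>n\<in>{1..N}. \<chi> n / of_nat n)))
      \<longlonglongrightarrow> norm (L1 - (\<Sum>n\<in>{1..N}. \<chi> n / of_nat n))"
    by (intro tendsto_intros)
  have "norm ((\<Sum>n<K. \<chi> n / of_nat n) - (\<Sum>n\<in>{1..N}. \<chi> n / of_nat n)) \<le> 2 * real m / (real N + 1)"
    if "K \<ge> Suc N" for K
  proof -
    have "(\<Sum>n\<in>{1..N}. \<chi> n / of_nat n) = (\<Sum>n<Suc N. \<chi> n / of_nat n)"
      by (rule sum.mono_neutral_left) (auto simp: not_le)
    hence "(\<Sum>n<K. \<chi> n / of_nat n) - (\<Sum>n\<in>{1..N}. \<chi> n / of_nat n) = (\<Sum>n\<in>{Suc N..<K}. \<chi> n / of_nat n)"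
      using sum_diff_nat_ivl[of 0 "Suc N" K "\<lambda>n. \<chi> n / of_nat n"] that by (simp add: atLeast0LessThan del: sum.lessThan_Suc)
    thus ?thesis using norm_tail_le[of "Suc N" K] by (simp add: add.commute)
  qed
  thus "\<exists>K0. \<forall>K\<ge>K0. norm ((\<Sum>n<K. \<chi> n / of_nat n) - (\<Sum>n\<in>{1..N}. \<chi> n / of_nat n)) \<le> 2 * real m / (real N + 1)"
    by blast
qed

lemma norm_L1_minus_partial_div_le:
  assumes "d > 0" "N > 0"
  shows "norm (L1 - (\<Sum>n\<in>{1..N div d}. \<chi> n / of_nat n)) \<le> 2 * real m * real d / real N"
proof -
  have "2 * real m / (real (N div d) + 1) \<le> 2 * real m / (real N / real d)"
    using assms nat_div_real_bounds(2)[of d N] by (intro divide_left_mono) auto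
  thus ?thesis using norm_L1_minus_partial_le[of "N div d"] by simp
qed

lemma norm_sum_ln_le: "\<exists>B. \<forall>N. norm (\<Sum>n\<in>{1..N}. \<chi> n * of_real (ln (real n) / real n)) \<le> B"
proof (intro exI allI)
  fix N
  define f where "f = (\<lambda>n. ln (real n) / real n)"
  \<comment> \<open>ln n / n decreases only from 3 on; the finitely many earlier terms are estimated
    separately.\<close>
  have "{1..N} = {1..<min 3 (Suc N)} \<union> {3..<Suc N}" by auto
  hence "(\<Sum>n\<in>{1..N}. \<chi> n * of_real (f n))
      = (\<Sum>n\<in>{1..<min 3 (Suc N)}. \<chi> n * of_real (f n)) + (\<Sum>n\<in>{3..<Suc N}. \<chi> n * of_real (f n))"
    by (simp only:) (rule sum.union_disjoint, auto)
  moreover have "norm (\<Sum>n\<in>{1..<min 3 (Suc N)}. \<chi> n * of_real (f n)) \<le> (\<Sum>n\<in>{1..<3}. norm (\<chi> n * of_real (f n)))"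
    by (rule order_trans[OF norm_sum]) (intro sum_mono2, auto)
  moreover have "norm (\<Sum>n\<in>{3..<Suc N}. \<chi> n * of_real (f n)) \<le> 2 * real m * f 3"
    by (rule norm_weighted_sum_le) (use ln_over_self_antimono in \<open>auto simp: f_def\<close>)
  ultimately have "norm (\<Sum>n\<in>{1..N}. \<chi> n * of_real (f n))
      \<le> (\<Sum>n\<in>{1..<3}. norm (\<chi> n * of_real (f n))) + 2 * real m * f 3"
    by (simp only: norm_triangle_le add_mono)
  thus "norm (\<Sum>n\<in>{1..N}. \<chi> n * of_real (ln (real n) / real n))
      \<le> (\<Sum>n\<in>{1..<3}. norm (\<chi> n * of_real (ln (real n) / real n))) + 2 * real m * (ln (real 3) / real 3)"
    by (simp add: f_def)
qed

text \<open>Expanding the logarithm as a divisor sum of \<open>mangoldt\<close> gives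
  \<open>L1\<close> times the Mangoldt sum, with \<open>L1\<close> replaced by its partial sums up
  to \<open>N div d\<close>. The errors total at most \<open>8 * m\<close>: 2 from the tail bound
  times 4 from Chebyshev.\<close>

lemma mangoldt_char_sum_bounded:
  assumes "L1 \<noteq> 0"
  shows "\<exists>B. \<forall>N>0. norm (mangoldt_char_sum \<chi> N) \<le> B"
proof -
  obtain B where B: "\<And>N. norm (\<Sum>n\<in>{1..N}. \<chi> n * of_real (ln (real n) / real n)) \<le> B"
    using norm_sum_ln_le by blast
  have "norm (mangoldt_char_sum \<chi> N) \<le> (B + 8 * real m) / norm L1" if N: "N > 0" for N
  proof -
    define E where "E = (\<lambda>d. L1 - (\<Sum>q\<in>{1..N div d}. \<chi> q / of_nat q))"
    define c where "c = (\<lambda>d. \<chi> d * mangoldt d / of_nat d)"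
    have "(\<Sum>n\<in>{1..N}. \<chi> n * of_real (ln (real n) / real n))
        = (\<Sum>n\<in>{1..N}. \<Sum>d | d dvd n. c d * (\<chi> (n div d) / of_nat (n div d)))"
    proof (intro sum.cong refl)
      fix n assume n: "n \<in> {1..N}"
      have "(\<Sum>d | d dvd n. c d * (\<chi> (n div d) / of_nat (n div d))) = (\<Sum>d | d dvd n. \<chi> n / of_nat n * mangoldt d)"
      proof (intro sum.cong refl)
        fix d assume "d \<in> {d. d dvd n}"
        then obtain q where q: "n = d * q" by auto
        with n have "d > 0" "q > 0" by (auto intro: Nat.gr0I)
        thus "c d * (\<chi> (n div d) / of_nat (n div d)) = \<chi> n / of_nat n * mangoldt d"
          using q by (simp add: c_def dchar_mult[OF dchar])
      qed
      also have "\<dots> = \<chi> n / of_nat n * of_real (ln (real n))"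
        using n by (subst sum_distrib_left [symmetric], subst mangoldt_sum) auto
      finally show "\<chi> n * of_real (ln (real n) / real n) = (\<Sum>d | d dvd n. c d * (\<chi> (n div d) / of_nat (n div d)))"
        by simp
    qed
    also have "\<dots> = (\<Sum>d\<in>{1..N}. \<Sum>q\<in>{1..N div d}. c d * (\<chi> q / of_nat q))"
      by (rule sum_divisors_swap)
    also have "\<dots> = (\<Sum>d\<in>{1..N}. c d * L1 - c d * E d)"
      by (intro sum.cong refl) (simp add: E_def sum_distrib_left right_diff_distrib)
    also have "\<dots> = L1 * mangoldt_char_sum \<chi> N - (\<Sum>d\<in>{1..N}. c d * E d)"
      by (simp add: sum_subtractf c_def mangoldt_char_sum_def sum_distrib_left mult.commute)
    finally have eq: "L1 * mangoldt_char_sum \<chi> N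
        = (\<Sum>n\<in>{1..N}. \<chi> n * of_real (ln (real n) / real n)) + (\<Sum>d\<in>{1..N}. c d * E d)" by simp
    have "norm (\<Sum>d\<in>{1..N}. c d * E d) \<le> (\<Sum>d\<in>{1..N}. (mangoldt d / real d) * (2 * real m * real d / real N))"
    proof (rule order_trans[OF norm_sum], rule sum_mono)
      fix d assume d: "d \<in> {1..N}"
      have "norm (c d) \<le> 1 * mangoldt d / real d" unfolding c_def norm_divide norm_mult norm_mangoldt norm_of_nat
        by (intro divide_right_mono mult_right_mono norm_le) (auto simp: mangoldt_nonneg)
      thus "norm (c d * E d) \<le> (mangoldt d / real d) * (2 * real m * real d / real N)"
        unfolding norm_mult E_def using d N
        by (intro mult_mono norm_L1_minus_partial_div_le) (auto simp: mangoldt_nonneg)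
    qed
    also have "\<dots> = 2 * real m / real N * (\<Sum>d\<in>{1..N}. mangoldt d)"
      by (subst sum_distrib_left, intro sum.cong refl) auto
    also have "\<dots> \<le> 2 * real m / real N * (4 * real N)"
      by (intro mult_left_mono sum_mangoldt_le) auto
    also have "\<dots> = 8 * real m" using N by simp
    finally have "norm (L1 * mangoldt_char_sum \<chi> N) \<le> B + 8 * real m"
      unfolding eq by (intro norm_triangle_le add_mono B)
    thus ?thesis using assms by (simp add: norm_mult field_simps)
  qed
  thus ?thesis by blast
qed

text \<open>If \<open>L(1,\<chi>) = 0\<close>, the inner sums in
  \<open>\<Sum>d\<le>N. \<mu>(d) \<chi>(d)/d ln(N/d) \<Sum>q\<le>N/d. \<chi>(q)/q\<close> are \<open>O(d/N)\<close>, while collecting the terms with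
  \<open>d q = n\<close> produces \<open>ln N\<close> from \<open>n = 1\<close> and the Mangoldt function from the other \<open>n\<close>.\<close>

lemma mangoldt_char_sum_of_zero:
  assumes "L1 = 0"
  shows "\<exists>B. \<forall>N>0. norm (mangoldt_char_sum \<chi> N + of_real (ln (real N))) \<le> B"
proof (intro exI allI impI)
  fix N :: nat assume N: "N > 0"
  define c where "c = (\<lambda>d. \<chi> d * of_real (moebius d * ln (real N / real d)) / of_nat d)"
  have "(\<Sum>n\<in>{1..N}. \<Sum>d | d dvd n. c d * (\<chi> (n div d) / of_nat (n div d)))
      = (\<Sum>n\<in>{1..N}. \<chi> n * mangoldt n / of_nat n + (if n = 1 then of_real (ln (real N)) else 0))"
  proof (intro sum.cong refl)
    fix n assume n: "n \<in> {1..N}"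
    have "(\<Sum>d | d dvd n. c d * (\<chi> (n div d) / of_nat (n div d)))
        = (\<Sum>d | d dvd n. \<chi> n / of_nat n * of_real (ln (real N) * moebius d - moebius d * ln (real d)))"
    proof (intro sum.cong refl)
      fix d assume "d \<in> {d. d dvd n}"
      then obtain q where q: "n = d * q" by auto
      with n have "d > 0" "q > 0" by (auto intro: Nat.gr0I)
      moreover from this have "moebius d * ln (real N / real d) = ln (real N) * moebius d - moebius d * ln (real d)"
        using N by (simp add: ln_div algebra_simps)
      hence "c d = \<chi> d * of_real (ln (real N) * moebius d - moebius d * ln (real d)) / of_nat d"
        unfolding c_def by (simp only:)
      ultimately show "c d * (\<chi> (n div d) / of_nat (n div d))
          = \<chi> n / of_nat n * of_real (ln (real N) * moebius d - moebius d * ln (real d))"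
        using q by (simp add: dchar_mult[OF dchar])
    qed
    also have "\<dots> = \<chi> n / of_nat n * of_real (ln (real N) * (\<Sum>d | d dvd n. moebius d) - (\<Sum>d | d dvd n. moebius d * ln (real d)))"
      by (simp only: sum_distrib_left [symmetric] of_real_sum [symmetric] sum_subtractf)
    also have "\<dots> = \<chi> n / of_nat n * of_real (ln (real N) * (if n = 1 then 1 else 0) + mangoldt n)"
      using n by (simp add: sum_moebius_divisors sum_moebius_ln_divisors)
    also have "\<dots> = \<chi> n * mangoldt n / of_nat n + (if n = 1 then of_real (ln (real N)) else 0)"
      by (simp add: algebra_simps dchar_1[OF dchar])
    finally show "(\<Sum>d | d dvd n. c d * (\<chi> (n div d) / of_nat (n div d))) = \<dots>" .
  qed
  also have "\<dots> = mangoldt_char_sum \<chi> N + of_real (ln (real N))"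
    using N by (simp add: sum.distrib mangoldt_char_sum_def)
  finally have "mangoldt_char_sum \<chi> N + of_real (ln (real N))
      = (\<Sum>d\<in>{1..N}. \<Sum>q\<in>{1..N div d}. c d * (\<chi> q / of_nat q))"
    using sum_divisors_swap[of "\<lambda>d q. c d * (\<chi> q / of_nat q)" N] by simp
  also have "\<dots> = (\<Sum>d\<in>{1..N}. c d * (\<Sum>q\<in>{1..N div d}. \<chi> q / of_nat q))"
    by (simp add: sum_distrib_left)
  also have "norm \<dots> \<le> (\<Sum>d\<in>{1..N}. (ln (real N / real d) / real d) * (2 * real m * real d / real N))"
  proof (rule order_trans[OF norm_sum], rule sum_mono)
    fix d assume d: "d \<in> {1..N}"
    have ln0: "ln (real N / real d) \<ge> 0" using d by (intro ln_ge_zero) auto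
    have "norm (\<chi> d) * \<bar>moebius d * ln (real N / real d)\<bar> \<le> 1 * (1 * ln (real N / real d))"
      unfolding abs_mult using ln0 by (intro mult_mono norm_le abs_moebius_le) auto
    hence "norm (c d) \<le> ln (real N / real d) / real d"
      unfolding c_def norm_divide norm_mult norm_of_real norm_of_nat by (intro divide_right_mono) auto
    moreover have "norm (\<Sum>q\<in>{1..N div d}. \<chi> q / of_nat q) \<le> 2 * real m * real d / real N"
      using norm_L1_minus_partial_div_le[of d N] assms d N by simp
    ultimately show "norm (c d * (\<Sum>q\<in>{1..N div d}. \<chi> q / of_nat q))
        \<le> (ln (real N / real d) / real d) * (2 * real m * real d / real N)"
      unfolding norm_mult using d ln0 by (intro mult_mono) auto
  qed
  also have "\<dots> = 2 * real m / real N * (\<Sum>d\<in>{1..N}. ln (real N) - ln (real d))"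
    using N by (subst sum_distrib_left, intro sum.cong refl) (auto simp: ln_div)
  also have "\<dots> = 2 * real m / real N * (real N * ln (real N) - ln (fact N))"
    by (simp add: sum_subtractf ln_fact_eq_sum_ln)
  \<comment> \<open>The lower Stirling bound says that the logarithms of N/d add up to at most N, so
    no factor ln N is lost.\<close>
  also have "\<dots> \<le> 2 * real m / real N * real N"
    using ln_fact_lower[of N] by (intro mult_left_mono) auto
  also have "\<dots> = 2 * real m" using N by simp
  finally show "norm (mangoldt_char_sum \<chi> N + of_real (ln (real N))) \<le> 2 * real m" .
qed

end

section \<open>Nonvanishing of the L-value at 1\<close>

lemma sum_divisors_mult_coprime:
  fixes f :: "nat \<Rightarrow> 'a :: comm_semiring_1"
  assumes "coprime a b" "a > 0" "b > 0" and mult: "\<And>x y. f (x * y) = f x * f y"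
  shows "(\<Sum>d | d dvd a * b. f d) = (\<Sum>d | d dvd a. f d) * (\<Sum>d | d dvd b. f d)"
proof -
  define D where "D = {d. d dvd a} \<times> {d. d dvd b}"
  have inj: "inj_on (\<lambda>(x, y). x * y) D"
  proof (rule inj_onI, clarsimp simp: D_def)
    fix x y x' y' assume *: "x dvd a" "y dvd b" "x' dvd a" "y' dvd b" "x * y = x' * y'"
    \<comment> \<open>The factor dividing \<open>a\<close> is recovered from the product by a gcd,
      which makes multiplication of divisors injective.\<close>
    have g: "gcd (u * v) a = u" if "u dvd a" "v dvd b" for u v
    proof -
      have "coprime a v" using that assms by (meson coprime_divisors dvd_refl)
      hence "gcd (u * v) a = gcd u a" by (rule gcd_mult_left_right_cancel)
      thus ?thesis using that by (simp add: gcd_proj1_iff)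
    qed
    have "x = x'" using g[of x y] g[of x' y'] * by metis
    moreover have "x > 0" using * assms by (auto intro: Nat.gr0I)
    ultimately show "x = x' \<and> y = y'" using * by simp
  qed
  have "(\<lambda>(x, y). x * y) ` D = {d. d dvd a * b}"
  proof (intro equalityI subsetI)
    fix d assume "d \<in> {d. d dvd a * b}"
    then obtain x y where "d = x * y" "x dvd a" "y dvd b" using division_decomp by blast
    thus "d \<in> (\<lambda>(x, y). x * y) ` D" by (auto simp: D_def)
  qed (auto simp: D_def mult_dvd_mono)
  hence "(\<Sum>d | d dvd a * b. f d) = (\<Sum>d\<in>(\<lambda>(x, y). x * y) ` D. f d)" by simp
  also have "\<dots> = (\<Sum>(x, y)\<in>D. f x * f y)"
    by (subst sum.reindex[OF inj]) (auto simp: mult case_prod_unfold)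
  also have "\<dots> = (\<Sum>d | d dvd a. f d) * (\<Sum>d | d dvd b. f d)"
    by (simp add: D_def sum_product sum.cartesian_product)
  finally show ?thesis .
qed

lemma sum_divisors_prime_power:
  fixes f :: "nat \<Rightarrow> 'a :: comm_monoid_add"
  assumes "prime p"
  shows "(\<Sum>d | d dvd p ^ k. f d) = (\<Sum>j\<le>k. f (p ^ j))"
proof -
  have "{d. d dvd p ^ k} = (\<lambda>j. p ^ j) ` {..k}"
    using divides_primepow_nat[OF assms, of _ k] by auto
  moreover have "inj_on (\<lambda>j. p ^ j) {..k}"
    using prime_gt_1_nat[OF assms] by (auto simp: inj_on_def)
  ultimately show ?thesis by (simp add: sum.reindex)
qed

lemma geometric_sum_nonneg:
  fixes x :: real
  assumes "\<bar>x\<bar> \<le> 1"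
  shows "(\<Sum>j\<le>k. x ^ j) \<ge> 0"
proof (cases "x = 1")
  case False
  hence "1 - x > 0" using assms by linarith
  moreover have "x ^ Suc k \<le> 1"
    using assms power_le_one[of "\<bar>x\<bar>" "Suc k"] abs_ge_self[of "x ^ Suc k"]
    unfolding power_abs by linarith
  hence "(1 - x) * (\<Sum>j\<le>k. x ^ j) \<ge> 0" unfolding sum_gp_basic by linarith
  ultimately show ?thesis using zero_le_mult_iff by (metis less_le_not_le)
qed simp

text \<open>Splitting off the full power of a prime \<open>p\<close> leaves a finite geometric sum
  in \<open>c p\<close>, which is nonnegative because \<open>c p\<close> lies between -1 and
  1.\<close>

lemma sum_divisors_multiplicative_nonneg:
  fixes c :: "nat \<Rightarrow> real"
  assumes mult: "\<And>x y. c (x * y) = c x * c y" and c1: "c 1 = 1" and bd: "\<And>x. \<bar>c x\<bar> \<le> 1"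
    and "n > 0"
  shows "(\<Sum>d | d dvd n. c d) \<ge> 0"
  using \<open>n > 0\<close>
proof (induction n rule: less_induct)
  case (less n)
  show ?case
  proof (cases "n = 1")
    case False
    then obtain p where p: "prime p" "p dvd n" using prime_factor_nat by blast
    obtain y where y: "n = p ^ multiplicity p n * y" "\<not> p dvd y"
      using multiplicity_decompose'[of n p] less.prems not_prime_unit p(1) by (metis less_irrefl)
    define k where "k = multiplicity p n"
    have k: "k > 0" using p less.prems by (simp add: k_def prime_multiplicity_gt_zero_iff)
    have y0: "y > 0" using y less.prems by (auto intro: Nat.gr0I)
    have p1: "p ^ k > 1" using prime_gt_1_nat[OF p(1)] k by (rule one_less_power)
    have "y < n" using y(1) mult_strict_right_mono[OF p1 y0] unfolding k_def by linarith
    hence IH: "(\<Sum>d | d dvd y. c d) \<ge> 0" using less.IH y0 by blast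
    have pw: "c (p ^ j) = c p ^ j" for j by (induction j) (simp_all add: mult c1[simplified])
    have "(\<Sum>d | d dvd p ^ k * y. c d) = (\<Sum>d | d dvd p ^ k. c d) * (\<Sum>d | d dvd y. c d)"
      using p y0 p1 y(2) by (intro sum_divisors_mult_coprime mult) (auto intro: prime_imp_coprime prime_gt_0_nat)
    also have "(\<Sum>d | d dvd p ^ k. c d) = (\<Sum>j\<le>k. c p ^ j)"
      by (simp add: sum_divisors_prime_power[OF p(1)] pw)
    also have "\<dots> * (\<Sum>d | d dvd y. c d) \<ge> 0"
      using IH geometric_sum_nonneg[OF bd] by simp
    finally show ?thesis using y(1) by (simp add: k_def)
  qed (use c1 in simp)
qed

section \<open>Lambert series and real characters\<close>

text \<open>The inequality of arithmetic and geometric means, applied to each pair of exponents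
  \<open>i\<close> and \<open>d - 1 - i\<close>.\<close>

lemma geometric_sum_lower:
  fixes s :: real
  assumes "s \<ge> 0"
  shows "real d * s ^ (d - 1) \<le> (\<Sum>i<d. (s\<^sup>2) ^ i)"
proof -
  have "2 * (\<Sum>i<d. (s\<^sup>2) ^ i) = (\<Sum>i<d. (s\<^sup>2) ^ i) + (\<Sum>i<d. (s\<^sup>2) ^ (d - Suc i))"
    using sum.nat_diff_reindex[of "\<lambda>i. (s\<^sup>2) ^ i" d] by simp
  also have "\<dots> = (\<Sum>i<d. (s\<^sup>2) ^ i + (s\<^sup>2) ^ (d - Suc i))"
    by (simp add: sum.distrib)
  also have "\<dots> \<ge> (\<Sum>i<d. 2 * s ^ (d - 1))"
  proof (rule sum_mono)
    fix i assume "i \<in> {..<d}"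
    hence e: "i + (d - Suc i) = d - 1" by auto
    have "0 \<le> (s ^ i - s ^ (d - Suc i))\<^sup>2" by simp
    also have "\<dots> = (s ^ i)\<^sup>2 + (s ^ (d - Suc i))\<^sup>2 - 2 * (s ^ i * s ^ (d - Suc i))"
      by (simp add: power2_eq_square algebra_simps)
    also have "s ^ i * s ^ (d - Suc i) = s ^ (d - 1)" unfolding power_add [symmetric] e ..
    finally show "2 * s ^ (d - 1) \<le> (s\<^sup>2) ^ i + (s\<^sup>2) ^ (d - Suc i)"
      by (simp add: power_mult [symmetric] mult.commute)
  qed
  finally show ?thesis by simp
qed

text \<open>The weight of the L-series at 1, scaled by 1/(1 - t), minus the Lambert kernel. Both
  parts behave like 1/(d (1 - t)) as t tends to 1.\<close>

definition lambert_gap :: "real \<Rightarrow> nat \<Rightarrow> real" where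
  "lambert_gap t d = 1 / (real d * (1 - t)) - t ^ d / (1 - t ^ d)"

text \<open>With G d = (1 - t^d)/(1 - t) and t = s^2, monotonicity amounts to d (d + 1) t^d \<le> G
  d * G (d + 1). The lower bounds d s^(d-1) and (d + 1) s^d for the two factors have product d (d +
  1) s^(2d-1), and s < 1 leaves one power of s to spare.\<close>

lemma lambert_gap_props:
  fixes t :: real
  assumes t: "0 < t" "t < 1" and d: "d > 0"
  shows "lambert_gap t d \<ge> 0" and "lambert_gap t (Suc d) \<le> lambert_gap t d"
proof -
  define G where "G = (\<lambda>d. \<Sum>i<d. t ^ i)"
  define s where "s = sqrt t"
  have s: "0 < s" "s < 1" "t = s\<^sup>2" using t by (auto simp: s_def)
  have GS: "1 - t ^ e = (1 - t) * G e" for e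
    using one_diff_power_eq[of t e] by (simp add: G_def)
  have low: "real e * s ^ (e - 1) \<le> G e" for e
    unfolding G_def s(3) by (rule geometric_sum_lower) (use s in simp)
  have G0: "G e > 0" if "e > 0" for e
  proof -
    have "0 < real e * s ^ (e - 1)" using that s by simp
    thus ?thesis using low[of e] by linarith
  qed
  have gap: "lambert_gap t e = (1 / real e - t ^ e / G e) / (1 - t)" for e
    unfolding lambert_gap_def GS by (simp add: diff_divide_distrib mult.commute)
  have "real d * t ^ d \<le> real d * s ^ (d - 1)"
    unfolding s(3) power_mult [symmetric] using s d by (intro mult_left_mono power_decreasing) auto
  hence "real d * t ^ d \<le> G d" using low[of d] by linarith
  hence "t ^ d / G d \<le> 1 / real d" using G0[OF d] d by (simp add: field_simps)
  thus "lambert_gap t d \<ge> 0" unfolding gap using t by simp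
  have "(real d * real (Suc d)) * t ^ d \<le> (real d * real (Suc d)) * s ^ (2 * d - 1)"
    unfolding s(3) power_mult [symmetric] using s d by (intro mult_left_mono power_decreasing) auto
  also have "2 * d - 1 = (d - 1) + d" using d by simp
  also have "(real d * real (Suc d)) * s ^ ((d - 1) + d) = (real d * s ^ (d - 1)) * (real (Suc d) * s ^ (Suc d - 1))"
    by (simp add: power_add)
  also have "\<dots> \<le> G d * G (Suc d)"
    using low[of d] low[of "Suc d"] s G0[OF d] by (intro mult_mono) auto
  finally have key: "(real d * real (Suc d)) * t ^ d \<le> G d * G (Suc d)" .
  have "t ^ d / G d - t ^ Suc d / G (Suc d) = t ^ d * (G (Suc d) - t * G d) / (G d * G (Suc d))"
    using G0[OF d] G0[of "Suc d"] by (simp add: field_simps)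
  also have "G (Suc d) - t * G d = 1"
    unfolding G_def sum.lessThan_Suc_shift by (simp add: sum_distrib_left)
  also have "t ^ d * 1 / (G d * G (Suc d)) \<le> 1 / (real d * real (Suc d))"
    using key G0[OF d] G0[of "Suc d"] d by (simp add: divide_le_eq le_divide_eq mult.commute del: of_nat_Suc)
  also have "\<dots> = 1 / real d - 1 / real (Suc d)" using d by (simp add: field_simps)
  finally have "1 / real (Suc d) - t ^ Suc d / G (Suc d) \<le> 1 / real d - t ^ d / G d" by linarith
  thus "lambert_gap t (Suc d) \<le> lambert_gap t d"
    unfolding gap using t by (intro divide_right_mono) auto
qed

context nonprincipal_dchar
begin

text \<open>Monsky's argument: with \<open>A n = \<Sum>d dvd n. \<chi> d\<close>, the Lambert series
  \<open>\<Sum>n. \<chi> n t^n / (1 - t^n) = \<Sum>n. A n t^n\<close> stays bounded as \<open>t\<close> tends to 1 if \<open>L(1,\<chi>) = 0\<close>, because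
  \<open>1 / (n (1 - t)) - t^n / (1 - t^n)\<close> decreases in \<open>n\<close>. It is truncated at \<open>N\<close> to avoid rearranging
  infinite sums.\<close>

lemma lambert_partial_sum_le:
  fixes c :: "nat \<Rightarrow> real"
  assumes L0: "L1 = 0" and c: "\<And>n. \<chi> n = of_real (c n)" and t: "0 < t" "t < 1" and N: "N > 0"
  shows "(\<Sum>n\<in>{1..N}. (\<Sum>d | d dvd n. c d) * t ^ n)
     \<le> 2 * real m / (real N + 1) / (1 - t) + 2 * real m + real N * t ^ N / (1 - t)"
proof -
  have c1: "\<bar>c n\<bar> \<le> 1" for n using norm_le[of n] by (simp add: c)
  have t1: "t ^ d \<le> t" if "d > 0" for d using that t power_decreasing[of 1 d t] by simp
  have "(\<Sum>n\<in>{1..N}. (\<Sum>d | d dvd n. c d) * t ^ n) = (\<Sum>n\<in>{1..N}. \<Sum>d | d dvd n. c d * t ^ (d * (n div d)))"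
    by (auto simp: sum_distrib_right intro!: sum.cong)
  also have "\<dots> = (\<Sum>d\<in>{1..N}. \<Sum>q\<in>{1..N div d}. c d * t ^ (d * q))"
    by (rule sum_divisors_swap)
  also have "\<dots> \<le> (\<Sum>d\<in>{1..N}. c d * (t ^ d / (1 - t ^ d)) + t ^ N / (1 - t))"
  proof (rule sum_mono)
    fix d assume d: "d \<in> {1..N}"
    define Q where "Q = N div d"
    have td: "t ^ d < 1" using t1[of d] d t by simp
    have geo: "(1 - t ^ d) * (\<Sum>q\<in>{1..Q}. (t ^ d) ^ q) = t ^ d - t ^ d * (t ^ d) ^ Q" for Q
    proof (induction Q)
      case (Suc Q)
      have "(1 - t ^ d) * (\<Sum>q\<in>{1..Suc Q}. (t ^ d) ^ q)
          = (1 - t ^ d) * (\<Sum>q\<in>{1..Q}. (t ^ d) ^ q) + (1 - t ^ d) * (t ^ d) ^ Suc Q"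
        by (simp add: distrib_left)
      thus ?case unfolding Suc.IH by (simp add: left_diff_distrib)
    qed simp
    have "(\<Sum>q\<in>{1..Q}. c d * t ^ (d * q)) = c d * (\<Sum>q\<in>{1..Q}. (t ^ d) ^ q)"
      by (simp add: sum_distrib_left power_mult)
    also have "(\<Sum>q\<in>{1..Q}. (t ^ d) ^ q) = t ^ d / (1 - t ^ d) - t ^ d * (t ^ d) ^ Q / (1 - t ^ d)"
      using geo[of Q] td by (simp add: eq_divide_eq mult.commute flip: diff_divide_distrib)
    finally have eq: "(\<Sum>q\<in>{1..Q}. c d * t ^ (d * q))
        = c d * (t ^ d / (1 - t ^ d)) - c d * (t ^ d * (t ^ d) ^ Q / (1 - t ^ d))"
      by (simp add: right_diff_distrib)
    \<comment> \<open>The first exponent missing from the truncated geometric series is d (Q + 1),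
      which is at least N.\<close>
    have "N \<le> d + d * Q" using d dividend_less_div_times[of d N] by (simp add: Q_def mult.commute)
    hence "t ^ d * (t ^ d) ^ Q \<le> t ^ N"
      unfolding power_mult [symmetric] power_add [symmetric] using t by (intro power_decreasing) auto
    hence "t ^ d * (t ^ d) ^ Q / (1 - t ^ d) \<le> t ^ N / (1 - t)"
      using t t1[of d] d td by (intro frac_le) auto
    moreover have "- c d * (t ^ d * (t ^ d) ^ Q / (1 - t ^ d)) \<le> 1 * (t ^ d * (t ^ d) ^ Q / (1 - t ^ d))"
      using c1[of d] t td by (intro mult_right_mono) auto
    ultimately show "(\<Sum>q\<in>{1..N div d}. c d * t ^ (d * q)) \<le> c d * (t ^ d / (1 - t ^ d)) + t ^ N / (1 - t)"
      using eq unfolding Q_def by linarith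
  qed
  also have "\<dots> = (\<Sum>d\<in>{1..N}. c d * (t ^ d / (1 - t ^ d))) + real N * t ^ N / (1 - t)"
    by (simp add: sum.distrib)
  also have "(\<Sum>d\<in>{1..N}. c d * (t ^ d / (1 - t ^ d)))
      = (\<Sum>d\<in>{1..N}. c d / real d) / (1 - t) - (\<Sum>d\<in>{1..N}. c d * lambert_gap t d)"
    by (simp add: lambert_gap_def sum_subtractf sum_divide_distrib right_diff_distrib)
  also have "\<dots> \<le> 2 * real m / (real N + 1) / (1 - t) + 2 * real m"
  proof -
    have "norm (of_real (\<Sum>d\<in>{1..N}. c d / real d) :: complex) \<le> 2 * real m / (real N + 1)"
      using norm_L1_minus_partial_le[of N] by (simp add: L0 c)
    hence "(\<Sum>d\<in>{1..N}. c d / real d) \<le> 2 * real m / (real N + 1)"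
      unfolding norm_of_real by linarith
    moreover have "norm (\<Sum>d\<in>{1..<Suc N}. \<chi> d * of_real (lambert_gap t d)) \<le> 2 * real m * lambert_gap t 1"
      by (rule norm_weighted_sum_le) (use lambert_gap_props[OF t] in auto)
    hence "norm (of_real (\<Sum>d\<in>{1..N}. c d * lambert_gap t d) :: complex) \<le> 2 * real m * lambert_gap t 1"
      by (simp add: c atLeastLessThanSuc_atLeastAtMost)
    \<comment> \<open>The first gap is 1 for every \<open>t\<close>, so the Abel bound is uniform as
      \<open>t\<close> approaches 1.\<close>
    moreover have "lambert_gap t 1 = 1"
      using t by (simp add: lambert_gap_def diff_divide_distrib [symmetric])
    ultimately have "\<bar>\<Sum>d\<in>{1..N}. c d * lambert_gap t d\<bar> \<le> 2 * real m"
      and "(\<Sum>d\<in>{1..N}. c d / real d) / (1 - t) \<le> 2 * real m / (real N + 1) / (1 - t)"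
      using t by (simp_all only: norm_of_real mult_1_right divide_right_mono diff_ge_0_iff_ge less_imp_le)
    thus ?thesis by linarith
  qed
  finally show ?thesis by simp
qed

text \<open>A zero would bound all partial sums of the nonnegative divisor sums \<open>A n\<close>
  by \<open>2 * m\<close>. But \<open>A\<close> equals 1 at every power of a prime dividing
  \<open>m\<close>, since \<open>\<chi>\<close> vanishes at all divisors of such a power except
  1.\<close>

lemma real_dchar_L1_nonzero:
  assumes real: "\<And>n. cnj (\<chi> n) = \<chi> n"
  shows "L1 \<noteq> 0"
proof
  assume L0: "L1 = 0"
  define c where "c = (\<lambda>n. Re (\<chi> n))"
  have c: "\<chi> n = of_real (c n)" for n using real[of n] by (simp add: c_def complex_eq_iff)
  define A where "A = (\<lambda>n. \<Sum>d | d dvd n. c d)"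
  have c1: "\<bar>c n\<bar> \<le> 1" for n using norm_le[of n] by (simp add: c)
  have cmult: "c (x * y) = c x * c y" for x y
    using dchar_mult[OF dchar, of x y] unfolding c of_real_mult [symmetric] of_real_eq_iff .
  have c_1: "c 1 = 1" using dchar_1[OF dchar] by (simp add: c_def)
  have A0: "A n \<ge> 0" if "n > 0" for n
    unfolding A_def by (rule sum_divisors_multiplicative_nonneg) (use cmult c_1 c1 that in auto)
  \<comment> \<open>The limits have to be taken in this order: the truncation errors contain 1/(1 -
    t) and vanish only when N tends to infinity for fixed t. Nonnegativity of \<open>A\<close>
    allows the sum to stay cut at K meanwhile.\<close>
  have bound_t: "(\<Sum>n\<in>{1..K}. A n * t ^ n) \<le> 2 * real m" if t: "0 < t" "t < 1" for t K
  proof (rule LIMSEQ_le_const)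
    have "(\<lambda>N. 2 * real m * inverse (real (Suc N)) / (1 - t) + 2 * real m + (real N * t ^ N) / (1 - t))
        \<longlonglongrightarrow> 2 * real m * 0 / (1 - t) + 2 * real m + 0 / (1 - t)"
      using t by (intro tendsto_intros LIMSEQ_inverse_real_of_nat powser_times_n_limit_0) auto
    thus "(\<lambda>N. 2 * real m / (real N + 1) / (1 - t) + 2 * real m + real N * t ^ N / (1 - t)) \<longlonglongrightarrow> 2 * real m"
      by (simp add: field_simps)
    have "(\<Sum>n\<in>{1..K}. A n * t ^ n) \<le> 2 * real m / (real N + 1) / (1 - t) + 2 * real m + real N * t ^ N / (1 - t)"
      if "N \<ge> Suc K" for N
    proof -
      have "(\<Sum>n\<in>{1..K}. A n * t ^ n) \<le> (\<Sum>n\<in>{1..N}. A n * t ^ n)"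
        using that t A0 by (intro sum_mono2) auto
      also have "\<dots> \<le> 2 * real m / (real N + 1) / (1 - t) + 2 * real m + real N * t ^ N / (1 - t)"
        unfolding A_def by (rule lambert_partial_sum_le[OF L0 c t]) (use that in simp)
      finally show ?thesis .
    qed
    thus "\<exists>N0. \<forall>N\<ge>N0. (\<Sum>n\<in>{1..K}. A n * t ^ n)
        \<le> 2 * real m / (real N + 1) / (1 - t) + 2 * real m + real N * t ^ N / (1 - t)" by blast
  qed
  have bound: "(\<Sum>n\<in>{1..K}. A n) \<le> 2 * real m" for K
  proof (rule tendsto_upperbound)
    show "((\<lambda>t. \<Sum>n\<in>{1..K}. A n * t ^ n) \<longlongrightarrow> (\<Sum>n\<in>{1..K}. A n)) (at_left 1)"
      by (auto intro!: tendsto_eq_intros)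
    show "\<forall>\<^sub>F t in at_left 1. (\<Sum>n\<in>{1..K}. A n * t ^ n) \<le> 2 * real m"
      using eventually_at_left_real[of 0 1] by (rule eventually_mono) (use bound_t in auto)
  qed simp
  obtain p where p: "prime p" "p dvd m" using modulus prime_factor_nat[of m] by auto
  have cp: "c p = 0"
    using dchar_eq_0_iff[OF dchar, of p] p by (auto simp: c_def coprime_absorb_left)
  have cpw: "c (p ^ j) = (if j = 0 then 1 else 0)" for j
    using c_1 by (cases j) (auto simp: cmult cp)
  have Ap: "A (p ^ k) = 1" for k
    unfolding A_def sum_divisors_prime_power[OF p(1)] cpw by simp
  \<comment> \<open>The exponents 0 to \<open>2 * m\<close> give \<open>2 * m + 1\<close> terms
    equal to 1, one more than the bound allows.\<close>
  define J where "J = 2 * m"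
  have p1: "p > 1" by (rule prime_gt_1_nat) fact
  have inj: "inj_on (\<lambda>j. p ^ j) {..J}" using p1 by (auto simp: inj_on_def)
  have "real (Suc J) = (\<Sum>n\<in>(\<lambda>j. p ^ j) ` {..J}. A n)"
    by (subst sum.reindex[OF inj]) (simp add: Ap)
  also have "\<dots> \<le> (\<Sum>n\<in>{1..p ^ J}. A n)"
    using p1 A0 by (intro sum_mono2) (auto simp: Suc_le_eq intro!: power_increasing)
  also have "\<dots> \<le> 2 * real m" by (rule bound)
  finally show False by (simp add: J_def)
qed

end

section \<open>Residue classes and Dirichlet's theorem\<close>

text \<open>The coefficient of ln N in the Mangoldt sum twisted by \<open>\<chi>\<close>;
  analytically, the pole order of the L-function at 1.\<close>

definition mangoldt_order :: "nat \<Rightarrow> (nat \<Rightarrow> complex) \<Rightarrow> real" where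
  "mangoldt_order m \<chi> = (if \<chi> = principal_dchar m then 1 else if dirichlet_L1 \<chi> = 0 then - 1 else 0)"

lemma mangoldt_char_sum_asymptotics:
  assumes "m > 1" "\<chi> \<in> dchars m"
  shows "\<exists>B. \<forall>N>0. norm (mangoldt_char_sum \<chi> N - of_real (mangoldt_order m \<chi> * ln (real N))) \<le> B"
proof (cases "\<chi> = principal_dchar m")
  case True
  thus ?thesis using mangoldt_principal_char_sum[of m] assms by (simp add: mangoldt_order_def)
next
  case False
  then interpret nonprincipal_dchar m \<chi> using assms by unfold_locales auto
  show ?thesis
    using False mangoldt_char_sum_of_zero mangoldt_char_sum_bounded by (cases "L1 = 0") (simp_all add: mangoldt_order_def)
qed

definition mangoldt_class_sum :: "nat \<Rightarrow> nat \<Rightarrow> nat \<Rightarrow> real" where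
  "mangoldt_class_sum m r N = (\<Sum>n\<in>{n\<in>{1..N}. [n = r] (mod m)}. mangoldt n / real n)"

text \<open>Orthogonality writes the class sum as a combination of the twisted sums with
  coefficients of modulus 1; the finitely many error bounds add up.\<close>

lemma mangoldt_class_sum_asymptotics:
  assumes m: "m > 1" and r: "coprime r m"
  shows "\<exists>B. \<forall>N>0. norm (of_real (real (card (dchars m)) * mangoldt_class_sum m r N)
     - (\<Sum>\<chi>\<in>dchars m. cnj (\<chi> r) * of_real (mangoldt_order m \<chi>)) * of_real (ln (real N))) \<le> B"
proof -
  have "\<forall>\<chi>\<in>dchars m. \<exists>B. \<forall>N>0. norm (mangoldt_char_sum \<chi> N - of_real (mangoldt_order m \<chi> * ln (real N))) \<le> B"
    using mangoldt_char_sum_asymptotics[OF m] by blast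
  then obtain B where B: "\<And>\<chi> N. \<chi> \<in> dchars m \<Longrightarrow> N > 0 \<Longrightarrow>
      norm (mangoldt_char_sum \<chi> N - of_real (mangoldt_order m \<chi> * ln (real N))) \<le> B \<chi>"
    by metis
  have "norm (of_real (real (card (dchars m)) * mangoldt_class_sum m r N)
     - (\<Sum>\<chi>\<in>dchars m. cnj (\<chi> r) * of_real (mangoldt_order m \<chi>)) * of_real (ln (real N))) \<le> (\<Sum>\<chi>\<in>dchars m. B \<chi>)"
    if N: "N > 0" for N
  proof -
    have "(\<Sum>\<chi>\<in>dchars m. cnj (\<chi> r) * mangoldt_char_sum \<chi> N)
        = (\<Sum>\<chi>\<in>dchars m. \<Sum>n\<in>{1..N}. (cnj (\<chi> r) * \<chi> n) * (mangoldt n / of_nat n))"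
      by (simp add: mangoldt_char_sum_def sum_distrib_left mult.assoc)
    also have "\<dots> = (\<Sum>n\<in>{1..N}. (\<Sum>\<chi>\<in>dchars m. cnj (\<chi> r) * \<chi> n) * (mangoldt n / of_nat n))"
      unfolding sum_distrib_right by (rule sum.swap)
    also have "\<dots> = (\<Sum>n\<in>{1..N}. if [n = r] (mod m) then of_nat (card (dchars m)) * (mangoldt n / of_nat n) else 0)"
      by (intro sum.cong refl) (simp add: dchars_orthogonality[OF m r])
    also have "\<dots> = (\<Sum>n\<in>{n\<in>{1..N}. [n = r] (mod m)}. of_nat (card (dchars m)) * (mangoldt n / of_nat n))"
      by (rule sum.inter_filter [symmetric]) simp
    also have "\<dots> = of_real (real (card (dchars m)) * mangoldt_class_sum m r N)"
      by (simp add: mangoldt_class_sum_def sum_distrib_left)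
    finally have "of_real (real (card (dchars m)) * mangoldt_class_sum m r N)
      - (\<Sum>\<chi>\<in>dchars m. cnj (\<chi> r) * of_real (mangoldt_order m \<chi>)) * of_real (ln (real N))
      = (\<Sum>\<chi>\<in>dchars m. cnj (\<chi> r) * (mangoldt_char_sum \<chi> N - of_real (mangoldt_order m \<chi> * ln (real N))))"
      by (simp add: right_diff_distrib sum_subtractf sum_distrib_right mult.assoc)
    also have "norm \<dots> \<le> (\<Sum>\<chi>\<in>dchars m. B \<chi>)"
    proof (rule order_trans[OF norm_sum], rule sum_mono)
      fix \<chi> assume \<chi>: "\<chi> \<in> dchars m"
      have "norm (cnj (\<chi> r)) * norm (mangoldt_char_sum \<chi> N - of_real (mangoldt_order m \<chi> * ln (real N))) \<le> 1 * B \<chi>"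
        using norm_dchar_le[OF \<chi>] m by (intro mult_mono B \<chi> N) auto
      thus "norm (cnj (\<chi> r) * (mangoldt_char_sum \<chi> N - of_real (mangoldt_order m \<chi> * ln (real N)))) \<le> B \<chi>"
        unfolding norm_mult by simp
    qed
    finally show ?thesis .
  qed
  thus ?thesis by blast
qed

lemma ln_nat_unbounded: "\<exists>N>0. ln (real N) > (B :: real)"
proof -
  obtain N :: nat where N: "real N > exp B" using reals_Archimedean2 by blast
  have "exp B > 0" by simp
  hence "real N > 0" using N by linarith
  hence "ln (exp B) < ln (real N)" using N by (subst ln_less_cancel_iff) auto
  thus ?thesis using \<open>real N > 0\<close> by (intro exI[of _ N]) auto
qed

lemma dirichlet_L1_cnj:
  assumes "nonprincipal_dchar m \<chi>"
  shows "dirichlet_L1 (\<lambda>n. cnj (\<chi> n)) = cnj (dirichlet_L1 \<chi>)"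
proof -
  have "(\<lambda>n. \<chi> n / of_nat n) sums dirichlet_L1 \<chi>"
    unfolding dirichlet_L1_def by (rule summable_sums) (rule nonprincipal_dchar.summable_L1[OF assms])
  hence "(\<lambda>n. cnj (\<chi> n / of_nat n)) sums cnj (dirichlet_L1 \<chi>)" by (simp only: sums_cnj)
  thus ?thesis by (simp add: dirichlet_L1_def sums_iff)
qed

lemma dirichlet_L1_nonzero:
  assumes m: "m > 1" and \<chi>: "\<chi> \<in> dchars m" "\<chi> \<noteq> principal_dchar m"
  shows "dirichlet_L1 \<chi> \<noteq> 0"
proof
  assume L0: "dirichlet_L1 \<chi> = 0"
  interpret nonprincipal_dchar m \<chi> using assms by unfold_locales auto
  define \<chi>' where "\<chi>' = (\<lambda>n. cnj (\<chi> n))"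
  have \<chi>': "\<chi>' \<in> dchars m" unfolding \<chi>'_def by (rule cnj_dchar) fact
  have np': "\<chi>' \<noteq> principal_dchar m"
  proof
    assume "\<chi>' = principal_dchar m"
    hence "cnj (cnj (\<chi> n)) = cnj (principal_dchar m n)" for n by (metis \<chi>'_def)
    hence "\<chi> = principal_dchar m" by (intro ext) (simp add: principal_dchar_def)
    thus False using \<chi> by simp
  qed
  have L0': "dirichlet_L1 \<chi>' = 0"
    unfolding \<chi>'_def dirichlet_L1_cnj[OF nonprincipal_dchar_axioms] by (simp add: L0)
  have "\<chi>' \<noteq> \<chi>" using real_dchar_L1_nonzero L0 by (metis \<chi>'_def)
  \<comment> \<open>These three characters contribute 1 - 1 - 1, and every other one contributes 0
    or -1, so the total is at most -1.\<close>
  define Y where "Y = {principal_dchar m, \<chi>, \<chi>'}"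
  have fin: "finite (dchars m)" using m by (simp add: finite_dchars)
  have "Y \<subseteq> dchars m" using \<chi> \<chi>' principal_dchar_in_dchars by (auto simp: Y_def)
  hence "(\<Sum>\<psi>\<in>dchars m. mangoldt_order m \<psi>) = (\<Sum>\<psi>\<in>dchars m - Y. mangoldt_order m \<psi>) + (\<Sum>\<psi>\<in>Y. mangoldt_order m \<psi>)"
    using fin by (rule sum.subset_diff)
  also have "(\<Sum>\<psi>\<in>dchars m - Y. mangoldt_order m \<psi>) \<le> 0"
    by (rule sum_nonpos) (auto simp: mangoldt_order_def Y_def)
  also have "(\<Sum>\<psi>\<in>Y. mangoldt_order m \<psi>) = - 1"
    using \<open>\<chi>' \<noteq> \<chi>\<close> \<chi>(2) np' L0 L0' unfolding Y_def by (simp add: mangoldt_order_def)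
  finally have neg: "(\<Sum>\<psi>\<in>dchars m. mangoldt_order m \<psi>) \<le> - 1" by simp
  define e where "e = (\<Sum>\<psi>\<in>dchars m. mangoldt_order m \<psi>)"
  \<comment> \<open>For the class of 1 all weights are 1, so the orders simply add up.\<close>
  have "(\<Sum>\<psi>\<in>dchars m. cnj (\<psi> 1) * of_real (mangoldt_order m \<psi>)) = of_real e"
    unfolding e_def of_real_sum by (intro sum.cong refl) (simp add: dchar_1)
  then obtain B where B: "\<And>N. N > 0 \<Longrightarrow> norm (of_real (real (card (dchars m)) * mangoldt_class_sum m 1 N)
     - of_real e * of_real (ln (real N)) :: complex) \<le> B"
    using mangoldt_class_sum_asymptotics[OF m coprime_1_left] by auto
  obtain N where N: "N > 0" "ln (real N) > B" using ln_nat_unbounded by blast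
  have "mangoldt_class_sum m 1 N \<ge> 0"
    unfolding mangoldt_class_sum_def by (intro sum_nonneg) (auto simp: mangoldt_nonneg)
  hence "0 \<le> real (card (dchars m)) * mangoldt_class_sum m 1 N" by simp
  moreover have "\<bar>real (card (dchars m)) * mangoldt_class_sum m 1 N - e * ln (real N)\<bar> \<le> B"
    using B[OF N(1)] unfolding of_real_mult [symmetric] of_real_diff [symmetric] norm_of_real .
  moreover have "e * ln (real N) \<le> - 1 * ln (real N)"
    using neg N(1) unfolding e_def by (intro mult_right_mono) auto
  ultimately show False using N(2) by linarith
qed

text \<open>With all nonprincipal L-values nonzero only the principal character contributes to the
  coefficient, so the class sum grows like ln N divided by the number of characters. Finitely many
  primes together with all higher prime powers would keep it bounded.\<close>

theorem dirichlet_primes: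
  fixes m r :: nat
  assumes m: "m > 1" and r: "coprime r m"
  shows "infinite {p. prime p \<and> [p = r] (mod m)}"
proof
  define P where "P = {p. prime p \<and> [p = r] (mod m)}"
  assume "finite {p. prime p \<and> [p = r] (mod m)}"
  hence finP: "finite P" by (simp add: P_def)
  define h where "h = card (dchars m)"
  have fin: "finite (dchars m)" using m by (simp add: finite_dchars)
  have "(\<Sum>\<chi>\<in>dchars m. cnj (\<chi> r) * of_real (mangoldt_order m \<chi>))
      = (\<Sum>\<chi>\<in>dchars m. if \<chi> = principal_dchar m then 1 else 0)"
    using r dirichlet_L1_nonzero[OF m]
    by (intro sum.cong refl) (auto simp: mangoldt_order_def principal_dchar_def)
  also have "\<dots> = 1" using fin principal_dchar_in_dchars by simp
  finally obtain B where B: "\<And>N. N > 0 \<Longrightarrow> norm (of_real (real h * mangoldt_class_sum m r N)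
     - of_real (ln (real N)) :: complex) \<le> B"
    using mangoldt_class_sum_asymptotics[OF m r] unfolding h_def by auto
  define C where "C = (\<Sum>p\<in>P. mangoldt p / real p :: real)"
  have le: "mangoldt_class_sum m r N \<le> 8 + C" for N
  proof -
    have "mangoldt_class_sum m r N \<le> (\<Sum>n\<in>{n\<in>{1..N}. \<not> prime n} \<union> P. mangoldt n / real n)"
      unfolding mangoldt_class_sum_def using finP
      by (intro sum_mono2) (auto simp: P_def mangoldt_nonneg)
    also have "\<dots> = (\<Sum>n\<in>{n\<in>{1..N}. \<not> prime n}. mangoldt n / real n) + C"
      unfolding C_def using finP by (intro sum.union_disjoint) (auto simp: P_def)
    finally show ?thesis using sum_mangoldt_nonprime_le[of N] by linarith
  qed
  obtain N where N: "N > 0" "ln (real N) > B + real h * (8 + C)" using ln_nat_unbounded by blast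
  have "\<bar>real h * mangoldt_class_sum m r N - ln (real N)\<bar> \<le> B"
    using B[OF N(1)] unfolding of_real_diff [symmetric] norm_of_real .
  moreover have "real h * mangoldt_class_sum m r N \<le> real h * (8 + C)"
    by (intro mult_left_mono le) auto
  ultimately show False using N(2) by linarith
qed

section \<open>Progressions of exceptional numbers\<close>

lemma progression_in_U_imp_common_factor:
  assumes M: "M > 0" and odds: "\<forall>n\<in>arith_prog M b. n > 0 \<and> odd n" and sub: "arith_prog M b \<subseteq> \<U>"
    and a: "a \<in> arith_prog M b"
  shows "M > 1" and "k > 0 \<Longrightarrow> gcd (int a - 2 ^ k) (int M) > 1"
proof -
  have in_prog: "M * h + b \<in> arith_prog M b" for h by (auto simp: arith_prog_def)
  \<comment> \<open>Two consecutive terms are odd, so their difference \<open>M\<close> is even and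
    cannot be 1.\<close>
  have "odd (M * 0 + b)" "odd (M * 1 + b)" using odds in_prog by blast+
  hence "even M" by simp
  with M show M1: "M > 1" by (cases "M = 1") auto
  assume k: "k > 0"
  obtain h0 where h0: "a = M * h0 + b" using a by (auto simp: arith_prog_def)
  show "gcd (int a - 2 ^ k) (int M) > 1"
  proof (rule ccontr)
    assume "\<not> gcd (int a - 2 ^ k) (int M) > 1"
    moreover have "gcd (int a - 2 ^ k) (int M) > 0" using M by simp
    ultimately have "gcd (int a - 2 ^ k) (int M) = 1" by linarith
    hence cop: "coprime (int a - 2 ^ k) (int M)" by (simp add: coprime_iff_gcd_eq_1)
    \<comment> \<open>The number a - 2^k may be negative; its least nonnegative residue is the class
      passed to Dirichlet's theorem.\<close>
    define r where "r = nat ((int a - 2 ^ k) mod int M)"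
    have r: "int r = (int a - 2 ^ k) mod int M" using M by (simp add: r_def)
    have "coprime (int r) (int M)" unfolding r using cop M by simp
    hence "coprime r M" by simp
    hence "infinite {p. prime p \<and> [p = r] (mod M)}" using M1 by (intro dirichlet_primes)
    then obtain p where p: "prime p" "[p = r] (mod M)" "p > a"
      by (auto simp: infinite_nat_iff_unbounded)
    have "[int p = int a - 2 ^ k] (mod int M)"
      using p(2) r by (metis cong_int_iff unique_euclidean_semiring_class.cong_def mod_mod_trivial)
    hence "int M dvd int p - (int a - 2 ^ k)" by (simp add: cong_iff_dvd_diff)
    \<comment> \<open>Because p > a, the difference is a natural number and p + 2^k lies further
      along the progression than a.\<close>
    also have "int p - (int a - 2 ^ k) = int (p + 2 ^ k - a)" using p(3) by (simp add: of_nat_diff)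
    finally have "M dvd p + 2 ^ k - a" by (simp only: int_dvd_int_iff)
    then obtain h where "p + 2 ^ k - a = M * h" by blast
    hence "p + 2 ^ k = M * (h0 + h) + b" using p(3) h0 by (simp add: algebra_simps)
    hence "p + 2 ^ k \<in> \<U>" using in_prog[of "h0 + h"] sub by auto
    thus False using p(1) k unfolding \<U>_def by blast
  qed
qed

text \<open>A prime of the form \<open>a + M h - 2^k\<close> must divide \<open>m\<close>. The factor \<open>2^t > max a m\<close> of \<open>M\<close> leaves
  only the case \<open>p = a\<close>, \<open>M h = 2^k\<close>, which the factor 3 excludes.\<close>

lemma common_factor_imp_progression_in_U:
  assumes aU: "a \<in> \<U>" and m: "m > (1 :: int)"
    and cf: "\<And>k :: nat. k > 0 \<Longrightarrow> gcd (int a - 2 ^ k) m > 1"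
  shows "\<exists>M>0. arith_prog M a \<subseteq> \<U>"
proof -
  define t where "t = a + nat m"
  have "t < 2 ^ t" by simp
  hence t: "a < 2 ^ t" "nat m < 2 ^ t" unfolding t_def by linarith+
  have t0: "t > 0" using m by (simp add: t_def)
  define M where "M = 3 * nat m * 2 ^ t"
  have M0: "M > 0" using m by (simp add: M_def)
  have oa: "odd a" "a > 0" using aU by (auto simp: \<U>_def)
  have evM: "even M" using t0 by (simp add: M_def)
  have "M * h + a \<in> \<U>" for h
  proof (cases "h = 0")
    case False
    have "\<not> (prime p \<and> k > 0 \<and> M * h + a = p + 2 ^ k)" for p k :: nat
    proof
      assume *: "prime p \<and> k > 0 \<and> M * h + a = p + 2 ^ k"
      define g where "g = gcd (int a - 2 ^ k) m"
      have g1: "g > 1" using cf * by (simp add: g_def)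
      have gm: "g dvd m" and ga: "g dvd int a - 2 ^ k" by (simp_all add: g_def)
      have mM: "m dvd int M" using m by (simp add: M_def)
      have "int (M * h + a) = int (p + 2 ^ k)" using * by (metis (no_types))
      hence "int p = int M * int h + (int a - 2 ^ k)" by simp
      moreover have "g dvd int M * int h + (int a - 2 ^ k)"
        using ga dvd_trans[OF gm mM] by (intro dvd_add dvd_mult2)
      ultimately have "g dvd int p" by simp
      hence "nat g dvd p" using g1 by (simp add: nat_dvd_iff)
      \<comment> \<open>The common factor exceeds 1 and divides the prime, so it is the prime
        itself; this forces p to divide m.\<close>
      hence "nat g = p" using * g1 prime_nat_iff[of p] by auto
      hence "int p dvd m" using gm g1 by auto
      hence "int p \<le> m" using m by (intro zdvd_imp_le) auto
      hence pm: "p \<le> nat m" by linarith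
      show False
      proof (cases "k < t")
        case True
        \<comment> \<open>Size comparison: the left side is at least 3 * 2^t + a, while p + 2^k is
          below 2 * 2^t.\<close>
        hence "(2 :: nat) ^ k \<le> 2 ^ t" by (intro power_increasing) auto
        moreover have "M * 1 \<le> M * h" using False by (intro mult_left_mono) auto
        moreover have "3 * 1 * 2 ^ t \<le> M" unfolding M_def using m by (intro mult_right_mono mult_left_mono) auto
        moreover have "M * h + a = p + 2 ^ k" using * by simp
        ultimately show False using pm t oa by linarith
      next
        case False
        have e: "M * h + a = p + 2 ^ k" using * by simp
        \<comment> \<open>Modulo 2^t both \<open>M * h\<close> and 2^k disappear, and a and p are
          smaller than 2^t, so the congruence is an equality.\<close>
        have "2 ^ t dvd M * h" by (simp add: M_def)
        hence "a mod 2 ^ t = (M * h + a) mod 2 ^ t" by (auto elim!: dvdE)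
        moreover have "(2 :: nat) ^ t dvd 2 ^ k" using False by (intro le_imp_power_dvd) simp
        hence "p mod 2 ^ t = (p + 2 ^ k) mod 2 ^ t" by (auto elim!: dvdE)
        ultimately have "a mod 2 ^ t = p mod 2 ^ t" by (simp only: e)
        hence "a = p" using t pm by simp
        hence "M * h = 2 ^ k" using e by simp
        hence "3 dvd (2 :: nat) ^ k" unfolding M_def by (metis dvd_triv_left mult.assoc)
        hence "3 dvd (2 :: nat)" using prime_dvd_power_nat[of 3 2 k] by simp
        thus False by simp
      qed
    qed
    thus ?thesis using oa evM by (auto simp: \<U>_def)
  qed (use aU in simp)
  hence "arith_prog M a \<subseteq> \<U>" by (auto simp: arith_prog_def)
  thus ?thesis using M0 by blast
qed

theorem theorem4:
  fixes a :: nat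
  assumes "a \<in> \<U>"
  shows "a \<in> \<Union> progressions_in_\<U> \<longleftrightarrow>
    (\<exists>m :: int. m > 1 \<and> (\<forall>k :: nat. k > 0 \<longrightarrow> gcd (int a - 2 ^ k) m > 1))"
proof
  assume "a \<in> \<Union> progressions_in_\<U>"
  then obtain M b where "M > 0" "\<forall>n\<in>arith_prog M b. n > 0 \<and> odd n" "arith_prog M b \<subseteq> \<U>" "a \<in> arith_prog M b"
    by (auto simp: progressions_in_\<U>_def)
  note * = progression_in_U_imp_common_factor[OF this]
  show "\<exists>m :: int. m > 1 \<and> (\<forall>k :: nat. k > 0 \<longrightarrow> gcd (int a - 2 ^ k) m > 1)"
    using * by (intro exI[of _ "int M"]) auto
next
  assume "\<exists>m :: int. m > 1 \<and> (\<forall>k :: nat. k > 0 \<longrightarrow> gcd (int a - 2 ^ k) m > 1)"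
  then obtain M where M: "M > 0" "arith_prog M a \<subseteq> \<U>"
    using common_factor_imp_progression_in_U[OF assms] by blast
  have "\<forall>n\<in>arith_prog M a. n > 0 \<and> odd n" using M(2) by (auto simp: \<U>_def)
  moreover have "a > 0" using assms by (simp add: \<U>_def)
  ultimately have "arith_prog M a \<in> progressions_in_\<U>"
    using M unfolding progressions_in_\<U>_def by blast
  moreover have "a \<in> arith_prog M a" by (auto simp: arith_prog_def intro: exI[of _ 0])
  ultimately show "a \<in> \<Union> progressions_in_\<U>" by blast
qed

end
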